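(* Assuming Kleene's quantifier $\exists^{2}$ (i.e. $\exists^2$ may be used as an additional oracle in all algorithms), the following specification is computationally equivalent to that of a Baire realiser: (k) A functional that on input a countable dense set $D\subset[0,1]$ (given together with a function $Y:[0,1]\to\mathbb N$ that is injective on $D$), a Baire 1 function $f:[0,1]\to\mathbb R$, and its oscillation function $\mathrm{osc}_{f}$, outputs either some $d\in D$ such that $f$ is discontinuous at $d$, or some $x\in[0,1]\setminus D$ such that $f$ is continuous at $x$. The equivalence remains correct if in (k) one requires that $Y$ restricted to $D$ is a bijection from $D$ to $\mathbb N$ (instead of an injection).
   Context: Metatheory: ZFC. Types and coding. Type $0$ is $\mathbb N$, type $1$ is $\mathbb N\to\mathbb N$, type $n+1$ is the type of maps from type $n$ objects to $\mathbb N$. Real numbers are coded by fast-converging Cauchy sequences of rationals, i.e. by type $1$ objects $(q_n)$ with $|q_n-q_{n+i}|<2^{-n}$. Functions $\mathbb R\to\mathbb R$ (or $[0,1]\to\mathbb R$, $[0,1]\to\mathbb N$) are given by maps on codes that send codes of equal reals to codes of equal reals (respectively to equal numbers). Subsets of $\mathbb R$ or $[0,1]$ are given by their characteristic functions, and no further information. When a functional outputs a real, it outputs a code for it. Computability is Kleene's S1-S9. The relation $\{e\}(\vec\Phi)=m$ ($e,m\in\mathbb N$, $\vec\Phi$ a finite list of finite-type objects) is inductively generated by: S1 successor $\{e\}(n,\vec\Phi)=n+1$; S2 constants; S3 projection $\{e\}(n,\vec\Phi)=n$; S4 composition $\{e\}(\vec\Phi)=\{e_1\}(\{e_2\}(\vec\Phi),\vec\Phi)$;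 S5 primitive recursion on $\mathbb N$; S6 permutation of arguments; S7 application of type $1$ arguments $\{e\}(f,n,\vec\Phi)=f(n)$; S8 $\{e\}(\Psi,\vec\Phi)=\Psi(\lambda\phi.\{d\}(\phi,\Psi,\vec\Phi))$ for $\Psi$ of type $k+2$, $\phi$ of type $k$; S9 $\{e\}(d,\vec\Phi,\vec\Psi)=\{d\}(\vec\Phi)$ (indices $e$ code the scheme and its parameters in a standard way). Oracles may be partial functionals: an S8 step is then defined exactly when $\lambda\phi.\{d\}(\phi,\Psi,\vec\Phi)$ is total and lies in the domain of $\Psi$. (The paper uses a lambda calculus with least fixed point operators that captures exactly S1-S9 on total objects and accommodates partial ones.) Functionals with outputs of higher type, such as reals, are computed argumentwise. Kleene's $\exists^2$ is the type $2$ functional $\varphi$ with $\varphi(f)=0$ if $(\exists n)(f(n)=0)$ and $\varphi(f)=1$ otherwise. A specification is a condition on (possibly partial) functionals: the functional must be defined on all inputs of the stated kind and produce an output with the stated property. Specifications (A) and (B) are computationally equivalent if there are indices $e,d\in\mathbb N$ such that for every functional $\Gamma$ satisfying (A), the functional $\{e\}(\Gamma)$ satisfies (B), and for every $\Lambda$ satisfying (B), the functional $\{d\}(\Lambda)$ satisfies (A). "Assuming $\exists^2$" means $\exists^2$ is also given as an argument to both algorithms. A Baire realiser is a functional that on input a sequence $(O_n)_{n\in\mathbb N}$ of dense and open subsets of $[0,1]$ outputs some $x\in\bigcap_{n\in\mathbb N}O_n$. A set $O$ is open if each $x\in O$ has some $k\in\mathbb N$ with $B(x,2^{-k})\subset O$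 (relative to $[0,1]$). A function $f:[0,1]\to\mathbb R$ is Baire 1 if it is the pointwise limit of a sequence of continuous functions. Oscillation: $\mathrm{osc}_f([a,b])=\sup_{x\in[a,b]}f(x)-\inf_{x\in[a,b]}f(x)$ (and likewise for balls) and $\mathrm{osc}_f(x)=\lim_{k\to\infty}\mathrm{osc}_f(B(x,2^{-k}))$, balls being taken within the domain. Convention on countable sets as inputs: a countable set $D$ is always given together with $Y:[0,1]\to\mathbb N$ that is injective on $D$, and both $D$ and $Y$ are inputs of the functional. *)

theory Defs
  imports "HOL-Analysis.Analysis" "HOL-Library.Nat_Bijection"
begin

section \<open>Finite-type objects and Kleene's S1-S9\<close>

type_synonym tp1 = "nat \<Rightarrow> nat"
type_synonym tp2 = "tp1 \<Rightarrow> nat"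

text \<open>Type 3 objects may be partial: the value \<open>None\<close> means undefined.\<close>

type_synonym ptp3 = "tp2 \<Rightarrow> nat option"

text \<open>
  S1-S9 never produce an argument of a type higher than those already present, so the
  types 0 to 3 are closed under subcomputations.  Objects of type 0, 1 and 2 are total.
\<close>

datatype arg = A0 nat | A1 tp1 | A2 tp2 | A3 ptp3

text \<open>
  \<open>kleene e \<Phi> m\<close> is the relation \<open>{e}(\<Phi>) = m\<close>.  An index is the number coding the list that
  consists of the number of the scheme followed by its parameters.  In S6 the parameter \<open>p\<close>
  lists the positions of the arguments in their new order; in S9 the parameter is the length
  of the argument list that is passed on.  S8 is split according to the type of the
  functional that is applied.
\<close>

inductive kleene :: "nat \<Rightarrow> arg list \<Rightarrow> nat \<Rightarrow> bool" where
  S1: "kleene (list_encode [1]) (A0 n # \<Phi>) (Suc n)"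
| S2: "kleene (list_encode [2, q]) \<Phi> q"
| S3: "kleene (list_encode [3]) (A0 n # \<Phi>) n"
| S4: "kleene e2 \<Phi> k \<Longrightarrow> kleene e1 (A0 k # \<Phi>) m \<Longrightarrow> kleene (list_encode [4, e1, e2]) \<Phi> m"
| S5_0: "kleene e1 \<Phi> m \<Longrightarrow> kleene (list_encode [5, e1, e2]) (A0 0 # \<Phi>) m"
| S5_Suc: "kleene (list_encode [5, e1, e2]) (A0 n # \<Phi>) k \<Longrightarrow> kleene e2 (A0 n # A0 k # \<Phi>) m \<Longrightarrow>
    kleene (list_encode [5, e1, e2]) (A0 (Suc n) # \<Phi>) m"
| S6: "distinct p \<Longrightarrow> set p = {..<length \<Phi>} \<Longrightarrow> kleene d (map (\<lambda>i. \<Phi> ! i) p) m \<Longrightarrow>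
    kleene (list_encode [6, list_encode p, d]) \<Phi> m"
| S7: "kleene (list_encode [7]) (A1 f # A0 n # \<Phi>) (f n)"
| S8_2: "(\<And>n. kleene d (A0 n # A2 \<Psi> # \<Phi>) (h n)) \<Longrightarrow>
    kleene (list_encode [8, d]) (A2 \<Psi> # \<Phi>) (\<Psi> h)"
| S8_3: "(\<And>f. kleene d (A1 f # A3 \<Psi> # \<Phi>) (H f)) \<Longrightarrow> \<Psi> H = Some m \<Longrightarrow>
    kleene (list_encode [8, d]) (A3 \<Psi> # \<Phi>) m"
| S9: "kleene d \<Phi> m \<Longrightarrow> kleene (list_encode [9, length \<Phi>]) (A0 d # \<Phi> @ \<Xi>) m"

lemma kleene_functional: "kleene e \<Phi> m \<Longrightarrow> kleene e \<Phi> m' \<Longrightarrow> m = m'"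
proof (induction arbitrary: m' rule: kleene.induct)
  case (S8_2 d \<Psi> \<Phi> h)
  from S8_2.prems obtain h' where "\<And>n. kleene d (A0 n # A2 \<Psi> # \<Phi>) (h' n)" "m' = \<Psi> h'"
    by (cases rule: kleene.cases) (auto simp: list_encode_eq)
  with S8_2.IH have "h = h'" by blast
  with \<open>m' = \<Psi> h'\<close> show ?case by simp
next
  case (S8_3 d \<Psi> \<Phi> H m)
  from S8_3.prems obtain H' where "\<And>f. kleene d (A1 f # A3 \<Psi> # \<Phi>) (H' f)" "\<Psi> H' = Some m'"
    by (cases rule: kleene.cases) (auto simp: list_encode_eq)
  moreover from this S8_3.IH have "H = H'" by blast
  ultimately show ?case using S8_3.hyps by simp
next
  case (S4 e2 \<Phi> k e1 m)
  from S4.prems show ?case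
    by (cases rule: kleene.cases) (use S4.IH in \<open>auto simp: list_encode_eq\<close>)
next
  case (S5_Suc e1 e2 n \<Phi> k m)
  from S5_Suc.prems show ?case
    by (cases rule: kleene.cases) (use S5_Suc.IH in \<open>auto simp: list_encode_eq\<close>)
next
  case (S5_0 e1 \<Phi> m e2)
  from S5_0.prems show ?case
    by (cases rule: kleene.cases) (use S5_0.IH in \<open>auto simp: list_encode_eq\<close>)
next
  case (S6 p \<Phi> d m)
  from S6.prems show ?case
    by (cases rule: kleene.cases) (use S6.IH in \<open>auto simp: list_encode_eq\<close>)
next
  case (S9 d \<Phi> m \<Xi>)
  from S9.prems show ?case
    by (cases rule: kleene.cases) (use S9.IH in \<open>auto simp: list_encode_eq\<close>)
qed (erule kleene.cases; simp add: list_encode_eq)+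

definition E2 :: tp2 where
  "E2 f = (if \<exists>n. f n = 0 then 0 else 1)"

text \<open>The partial functional \<open>{e}(\<Gamma>)\<close>, with \<open>E2\<close> as an additional oracle.\<close>

definition computed :: "nat \<Rightarrow> ptp3 \<Rightarrow> ptp3" where
  "computed e \<Gamma> F =
    (if \<exists>m. kleene e [A2 F, A3 \<Gamma>, A2 E2] m
     then Some (THE m. kleene e [A2 F, A3 \<Gamma>, A2 E2] m) else None)"

definition comp_equiv_E2 :: "(ptp3 \<Rightarrow> bool) \<Rightarrow> (ptp3 \<Rightarrow> bool) \<Rightarrow> bool" where
  "comp_equiv_E2 A B \<longleftrightarrow>
    (\<exists>e d. (\<forall>\<Gamma>. A \<Gamma> \<longrightarrow> B (computed e \<Gamma>)) \<and> (\<forall>\<Lambda>. B \<Lambda> \<longrightarrow> A (computed d \<Lambda>)))"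


section \<open>Coding of inputs and outputs\<close>

text \<open>
  \<open>join\<close> codes a sequence of type 2 objects as one type 2 object: the number in front of the
  argument selects the member of the sequence that is applied to the rest.
\<close>

definition join :: "(nat \<Rightarrow> tp2) \<Rightarrow> tp2" where
  "join F g = F (g 0) (\<lambda>i. g (Suc i))"

definition tuple :: "tp2 list \<Rightarrow> tp2" where
  "tuple Fs = join (\<lambda>i. if i < length Fs then Fs ! i else (\<lambda>_. 0))"

text \<open>
  On the inputs \<open>Fs\<close> the functional \<open>\<Gamma>\<close> outputs the type 1 object \<open>p\<close>.  The output is computed
  argumentwise; the number argument \<open>n\<close> is passed as the first component of the input, in
  the form of a constant type 2 object.
\<close>

definition outputs :: "ptp3 \<Rightarrow> tp2 list \<Rightarrow> tp1 \<Rightarrow> bool" where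
  "outputs \<Gamma> Fs p \<longleftrightarrow> (\<forall>n. \<Gamma> (tuple ((\<lambda>_. n) # Fs)) = Some (p n))"

definition codes_real :: "tp1 \<Rightarrow> real \<Rightarrow> bool" where
  "codes_real p x \<longleftrightarrow>
    (\<forall>n i. \<bar>nat_to_rat_surj (p n) - nat_to_rat_surj (p (n + i))\<bar> < 1 / 2 ^ n) \<and>
    (\<lambda>n. real_of_rat (nat_to_rat_surj (p n))) \<longlonglongrightarrow> x"

text \<open>
  Codes of objects on \<open>[0,1]\<close>.  Since a type 2 object is total, it also has values at arguments
  that code no element of \<open>[0,1]\<close>; these values are arbitrary.
\<close>

definition codes_nat_fun :: "tp2 \<Rightarrow> (real \<Rightarrow> nat) \<Rightarrow> bool" where
  "codes_nat_fun F Y \<longleftrightarrow> (\<forall>x\<in>{0..1}. \<forall>p. codes_real p x \<longrightarrow> F p = Y x)"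

definition codes_set :: "tp2 \<Rightarrow> real set \<Rightarrow> bool" where
  "codes_set F A \<longleftrightarrow> codes_nat_fun F (\<lambda>x. if x \<in> A then 1 else 0)"

text \<open>
  A map from type 1 objects to type 1 objects is coded by a type 2 object that takes the
  number argument of the value in front, as in \<open>join\<close>.
\<close>

definition codes_real_fun :: "tp2 \<Rightarrow> (real \<Rightarrow> real) \<Rightarrow> bool" where
  "codes_real_fun F f \<longleftrightarrow>
    (\<forall>x\<in>{0..1}. \<forall>p. codes_real p x \<longrightarrow> codes_real (\<lambda>n. F (case_nat n p)) (f x))"


section \<open>The specifications\<close>

definition baire_realiser :: "ptp3 \<Rightarrow> bool" where
  "baire_realiser \<Gamma> \<longleftrightarrow>
    (\<forall>Os Fs.
      (\<forall>n. Os n \<subseteq> {0..1} \<and> {0..1} \<subseteq> closure (Os n) \<and> openin (top_of_set {0..1}) (Os n) \<and>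
           codes_set (Fs n) (Os n)) \<longrightarrow>
      (\<exists>p x. outputs \<Gamma> [join Fs] p \<and> codes_real p x \<and> x \<in> (\<Inter>n. Os n)))"

definition baire1 :: "(real \<Rightarrow> real) \<Rightarrow> bool" where
  "baire1 f \<longleftrightarrow>
    (\<exists>s. (\<forall>n::nat. continuous_on {0..1} (s n)) \<and> (\<forall>x\<in>{0..1}. (\<lambda>n. s n x) \<longlonglongrightarrow> f x))"

text \<open>The oscillation is infinite where \<open>f\<close> is not locally bounded, hence the extended reals.\<close>

definition osc_on :: "(real \<Rightarrow> real) \<Rightarrow> real set \<Rightarrow> ereal" where
  "osc_on f A = (SUP x\<in>A. ereal (f x)) - (INF x\<in>A. ereal (f x))"

definition osc :: "(real \<Rightarrow> real) \<Rightarrow> real \<Rightarrow> ereal" where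
  "osc f x = lim (\<lambda>k. osc_on f (ball x (1 / 2 ^ k) \<inter> {0..1}))"

text \<open>
  The parameter \<open>R\<close> is the condition on \<open>Y\<close> and \<open>D\<close>.  The oscillation function is an input
  from \<open>[0,1]\<close> to the reals, so the inputs are those \<open>f\<close> whose oscillation is finite everywhere.
\<close>

definition spec_k :: "((real \<Rightarrow> nat) \<Rightarrow> real set \<Rightarrow> bool) \<Rightarrow> ptp3 \<Rightarrow> bool" where
  "spec_k R \<Gamma> \<longleftrightarrow>
    (\<forall>D Y f g FD FY Ff Fg.
      D \<subseteq> {0..1} \<and> countable D \<and> {0..1} \<subseteq> closure D \<and> R Y D \<and>
      baire1 f \<and> (\<forall>x\<in>{0..1}. osc f x = ereal (g x)) \<and>
      codes_set FD D \<and> codes_nat_fun FY Y \<and> codes_real_fun Ff f \<and> codes_real_fun Fg g \<longrightarrow>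
      (\<exists>p x. outputs \<Gamma> [FD, FY, Ff, Fg] p \<and> codes_real p x \<and>
         (x \<in> D \<and> \<not> continuous (at x within {0..1}) f \<or>
          x \<in> {0..1} - D \<and> continuous (at x within {0..1}) f)))"

end

theory Submission
  imports Defs
begin

text \<open>
  Each reduction queries its oracle once and hands over the answer, so all that has to be
  computed is the query, a type 2 object, from the type 2 input.

  A point of continuity outside \<open>D\<close> is a point of all the sets
  \<open>{x. osc f x < 2^-m} - {x \<in> D. Y x \<le> m}\<close>, which are open, and dense because \<open>f\<close> is Baire 1.

  Conversely, given dense open sets \<open>O_n\<close>, let \<open>d_i\<close> be a point of \<open>O_0 \<inter> \<dots> \<inter> O_i\<close> in the \<open>i\<close>-th
  basic interval.  These points can be found among the dyadic rationals.  The set \<open>D\<close> of all of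
  them is dense, and it meets the complement of \<open>O_m\<close> in a subset of \<open>{d_i. i < m}\<close> only.
  Hence this complement minus \<open>D\<close> is a union over \<open>j\<close> of the sets
  \<open>{x. x \<notin> O_m and |x - d_i| \<ge> 2^-j for all i < m}\<close>, which are closed and disjoint from \<open>D\<close>.
  Let \<open>f x\<close> be \<open>2^-k\<close> for the least \<open>k\<close> such that \<open>x\<close> is in the \<open>k\<close>-th of these sets (over all pairs
  \<open>(m, j)\<close>), and \<open>0\<close> if there is none.  Then \<open>f\<close> is upper semicontinuous and vanishes on \<open>D\<close>, so
  it is Baire 1, is its own oscillation function and is continuous on \<open>D\<close>, and it is
  continuous at a point outside \<open>D\<close> only if this point is in every \<open>O_m\<close>.
\<close>

subsection \<open>Closure properties of S1-S9\<close>

declare list_encode.simps [simp del]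

text \<open>These are the arguments present when S8 applies the oracle: the bound type 1 object, the
  oracle, \<open>E2\<close> and the input. In \<open>computable\<close> the value does not depend on
  the oracle, so a query is determined by the input alone.\<close>

definition tail :: "tp1 \<Rightarrow> ptp3 \<Rightarrow> tp2 \<Rightarrow> arg list" where
  "tail f \<Gamma> F = [A1 f, A3 \<Gamma>, A2 E2, A2 F]"

text \<open>
  The list \<open>v\<close> is an environment of numbers.  A binder puts its number in front, so the
  variables are \<open>hd v\<close>, \<open>hd (tl v)\<close>, and so on.
\<close>

definition computable :: "nat \<Rightarrow> (nat list \<Rightarrow> tp1 \<Rightarrow> tp2 \<Rightarrow> nat) \<Rightarrow> bool" where
  "computable k \<phi> \<longleftrightarrow>
    (\<exists>e. \<forall>v f \<Gamma> F. length v = k \<longrightarrow> kleene e (map A0 v @ tail f \<Gamma> F) (\<phi> v f F))"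

lemma computableI:
  assumes "\<And>v f \<Gamma> F. length v = k \<Longrightarrow> kleene e (map A0 v @ tail f \<Gamma> F) (\<phi> v f F)"
  shows "computable k \<phi>"
  using assms unfolding computable_def by blast

text \<open>The schemes act on the front of the argument list, so S6 has to bring the wanted
  argument there. Exchanging two adjacent blocks, of lengths \<open>b\<close> and \<open>c\<close>,
  covers almost every case.\<close>

definition swap_blocks :: "nat \<Rightarrow> nat \<Rightarrow> nat \<Rightarrow> nat \<Rightarrow> nat \<Rightarrow> nat" where
  "swap_blocks a b c l d = list_encode
    [6, list_encode ([0..<a] @ [a+b..<a+b+c] @ [a..<a+b] @ [a+b+c..<a+b+c+l]), d]"

lemma kleene_swap_blocks:
  assumes "length xs = a" "length ys = b" "length zs = c" "length ws = l"
    and "kleene d (xs @ zs @ ys @ ws) m"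
  shows "kleene (swap_blocks a b c l d) (xs @ ys @ zs @ ws) m"
proof -
  let ?L = "xs @ ys @ zs @ ws"
  have "map (\<lambda>i. ?L ! i) [0..<a] = xs"
    "map (\<lambda>i. ?L ! i) [a+b..<a+b+c] = zs"
    "map (\<lambda>i. ?L ! i) [a..<a+b] = ys"
    "map (\<lambda>i. ?L ! i) [a+b+c..<a+b+c+l] = ws"
    using assms(1-4) by (auto intro!: nth_equalityI simp: nth_append)
  thus ?thesis unfolding swap_blocks_def using assms by (intro S6) auto
qed

lemma computable_const: "computable k (\<lambda>v f F. c)"
  by (rule computableI) (rule S2)

lemma computable_hd: "computable (Suc k) (\<lambda>v f F. hd v)"
proof (rule computableI)
  fix v :: "nat list" and f \<Gamma> F
  assume "length v = Suc k"
  then obtain n w where "v = n # w" by (cases v) auto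
  thus "kleene (list_encode [3]) (map A0 v @ tail f \<Gamma> F) (hd v)" by (simp add: S3)
qed

lemma computable_weaken:
  assumes "computable k \<phi>"
  shows "computable (Suc k) (\<lambda>v f F. \<phi> (tl v) f F)"
proof -
  from assms obtain d where d: "\<And>v f \<Gamma> F. length v = k \<Longrightarrow>
    kleene d (map A0 v @ tail f \<Gamma> F) (\<phi> v f F)" unfolding computable_def by blast
  let ?nine = "list_encode [9, k + 4]"
  show ?thesis
  proof (rule computableI)
    fix v :: "nat list" and f \<Gamma> F
    assume "length v = Suc k"
    then obtain n w where v: "v = n # w" "length w = k" by (cases v) auto
    let ?c = "map A0 w @ tail f \<Gamma> F"
    have l: "length ?c = k + 4" using v by (simp add: tail_def)
    have "kleene ?nine ([A0 d] @ ?c @ [A0 n] @ []) (\<phi> w f F)"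
      using S9[OF d[OF v(2)], of f \<Gamma> F "[A0 n]"] l by simp
    hence "kleene (swap_blocks 1 1 (k + 4) 0 ?nine) ([A0 d] @ [A0 n] @ ?c @ []) (\<phi> w f F)"
      using l by (intro kleene_swap_blocks) auto
    hence "kleene (list_encode [4, swap_blocks 1 1 (k + 4) 0 ?nine, list_encode [2, d]]) (A0 n # ?c) (\<phi> w f F)"
      by (intro S4[OF S2]) simp
    thus "kleene (list_encode [4, swap_blocks 1 1 (k + 4) 0 ?nine, list_encode [2, d]])
        (map A0 v @ tail f \<Gamma> F) (\<phi> (tl v) f F)"
      using v by simp
  qed
qed

lemmas computable_var =
  computable_hd
  computable_weaken[OF computable_hd]
  computable_weaken[OF computable_weaken[OF computable_hd]]
  computable_weaken[OF computable_weaken[OF computable_weaken[OF computable_hd]]]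
  computable_weaken[OF computable_weaken[OF computable_weaken[OF computable_weaken[OF computable_hd]]]]

lemma computable_let:
  assumes "computable k a" "computable (Suc k) (\<lambda>v f F. b (hd v) (tl v) f F)"
  shows "computable k (\<lambda>v f F. b (a v f F) v f F)"
proof -
  from assms(1) obtain d where d: "\<And>v f \<Gamma> F. length v = k \<Longrightarrow>
    kleene d (map A0 v @ tail f \<Gamma> F) (a v f F)" unfolding computable_def by blast
  from assms(2) obtain e where e: "\<And>v f \<Gamma> F. length v = Suc k \<Longrightarrow>
    kleene e (map A0 v @ tail f \<Gamma> F) (b (hd v) (tl v) f F)" unfolding computable_def by blast
  show ?thesis
  proof (rule computableI)
    fix v :: "nat list" and f \<Gamma> F
    assume "length v = k"
    thus "kleene (list_encode [4, e, d]) (map A0 v @ tail f \<Gamma> F) (b (a v f F) v f F)"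
      using S4[OF d] e[of "a v f F # v" f \<Gamma> F] by simp
  qed
qed

lemma computable_Suc:
  assumes "computable k a"
  shows "computable k (\<lambda>v f F. Suc (a v f F))"
proof (rule computable_let[OF assms])
  show "computable (Suc k) (\<lambda>v f F. Suc (hd v))"
  proof (rule computableI)
    fix v :: "nat list" and f \<Gamma> F
    assume "length v = Suc k"
    then obtain n w where v: "v = n # w" by (cases v) auto
    show "kleene (list_encode [1]) (map A0 v @ tail f \<Gamma> F) (Suc (hd v))"
      unfolding v list.map append_Cons list.sel by (rule S1)
  qed
qed

lemma computable_app1:
  assumes "computable k a"
  shows "computable k (\<lambda>v f F. f (a v f F))"
proof (rule computable_let[OF assms])
  \<comment> \<open>S7 wants the function first and then its argument. Behind the
    \<open>k + 1\<close> numbers \<open>f\<close> has position \<open>k + 1\<close>; the number it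
    is applied to has position 0.\<close>
  let ?p = "[k + 1, 0] @ [1..<k + 1] @ [k + 2..<k + 5]"
  show "computable (Suc k) (\<lambda>v f F. f (hd v))"
  proof (rule computableI)
    fix v :: "nat list" and f \<Gamma> F
    assume "length v = Suc k"
    then obtain n w where "v = n # w" "length w = k" by (cases v) auto
    thus "kleene (list_encode [6, list_encode ?p, list_encode [7]]) (map A0 v @ tail f \<Gamma> F) (f (hd v))"
      by (intro S6) (auto simp: tail_def nth_append S7)
  qed
qed

text \<open>S8 needs \<open>F\<close> in front and evaluates the body with the bound number before
  \<open>F\<close>. So \<open>F\<close> is moved to the front outside, and \<open>?d\<close> moves
  it back behind the other arguments inside.\<close>

lemma computable_app2:
  assumes "computable (Suc k) (\<lambda>v f F. a (hd v) (tl v) f F)"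
  shows "computable k (\<lambda>v f F. F (\<lambda>n. a n v f F))"
proof -
  from assms obtain d where d: "\<And>v f \<Gamma> F. length v = Suc k \<Longrightarrow>
    kleene d (map A0 v @ tail f \<Gamma> F) (a (hd v) (tl v) f F)" unfolding computable_def by blast
  let ?d = "swap_blocks 1 1 (k + 3) 0 d"
  show ?thesis
  proof (rule computableI)
    fix v :: "nat list" and f \<Gamma> F
    assume v: "length v = k"
    let ?c = "map A0 v @ [A1 f, A3 \<Gamma>, A2 E2]"
    have "kleene ?d ([A0 n] @ [A2 F] @ ?c @ []) (a n v f F)" for n
      using d[of "n # v" f \<Gamma> F] v by (intro kleene_swap_blocks) (auto simp: tail_def)
    hence "kleene (list_encode [8, ?d]) ([] @ [A2 F] @ ?c @ []) (F (\<lambda>n. a n v f F))"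
      by (simp add: S8_2)
    hence "kleene (swap_blocks 0 (k + 3) 1 0 (list_encode [8, ?d])) ([] @ ?c @ [A2 F] @ []) (F (\<lambda>n. a n v f F))"
      using v by (intro kleene_swap_blocks) auto
    thus "kleene (swap_blocks 0 (k + 3) 1 0 (list_encode [8, ?d])) (map A0 v @ tail f \<Gamma> F) (F (\<lambda>n. a n v f F))"
      by (simp add: tail_def)
  qed
qed

lemma computable_E2:
  assumes "computable (Suc k) (\<lambda>v f F. a (hd v) (tl v) f F)"
  shows "computable k (\<lambda>v f F. E2 (\<lambda>n. a n v f F))"
proof -
  from assms obtain d where d: "\<And>v f \<Gamma> F. length v = Suc k \<Longrightarrow>
    kleene d (map A0 v @ tail f \<Gamma> F) (a (hd v) (tl v) f F)" unfolding computable_def by blast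
  let ?d = "swap_blocks 1 1 (k + 2) 1 d"
  show ?thesis
  proof (rule computableI)
    fix v :: "nat list" and f \<Gamma> F
    assume v: "length v = k"
    let ?c = "map A0 v @ [A1 f, A3 \<Gamma>]"
    have "kleene ?d ([A0 n] @ [A2 E2] @ ?c @ [A2 F]) (a n v f F)" for n
      using d[of "n # v" f \<Gamma> F] v by (intro kleene_swap_blocks) (auto simp: tail_def)
    hence "kleene (list_encode [8, ?d]) ([] @ [A2 E2] @ ?c @ [A2 F]) (E2 (\<lambda>n. a n v f F))"
      by (simp add: S8_2)
    hence "kleene (swap_blocks 0 (k + 2) 1 1 (list_encode [8, ?d])) ([] @ ?c @ [A2 E2] @ [A2 F]) (E2 (\<lambda>n. a n v f F))"
      using v by (intro kleene_swap_blocks) auto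
    thus "kleene (swap_blocks 0 (k + 2) 1 1 (list_encode [8, ?d])) (map A0 v @ tail f \<Gamma> F) (E2 (\<lambda>n. a n v f F))"
      by (simp add: tail_def)
  qed
qed

lemma computable_rec:
  assumes "computable k b" "computable k a"
    and "computable (Suc (Suc k)) (\<lambda>v f F. c (hd v) (hd (tl v)) (tl (tl v)) f F)"
  shows "computable k (\<lambda>v f F. rec_nat (a v f F) (\<lambda>n r. c n r v f F) (b v f F))"
proof (rule computable_let[OF assms(1)])
  from assms(2) obtain d where d: "\<And>v f \<Gamma> F. length v = k \<Longrightarrow>
    kleene d (map A0 v @ tail f \<Gamma> F) (a v f F)" unfolding computable_def by blast
  from assms(3) obtain e where e: "\<And>v f \<Gamma> F. length v = Suc (Suc k) \<Longrightarrow>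
    kleene e (map A0 v @ tail f \<Gamma> F) (c (hd v) (hd (tl v)) (tl (tl v)) f F)"
    unfolding computable_def by blast
  show "computable (Suc k) (\<lambda>v f F. rec_nat (a (tl v) f F) (\<lambda>n r. c n r (tl v) f F) (hd v))"
  proof (rule computableI)
    fix v :: "nat list" and f \<Gamma> F
    assume "length v = Suc k"
    then obtain n w where v: "v = n # w" "length w = k" by (cases v) auto
    have "kleene (list_encode [5, d, e]) (A0 n # map A0 w @ tail f \<Gamma> F)
        (rec_nat (a w f F) (\<lambda>n r. c n r w f F) n)"
    proof (induction n)
      case 0
      show ?case using S5_0[OF d[OF v(2)]] by simp
    next
      case (Suc n)
      show ?case
        using S5_Suc[OF Suc, of _] e[of "n # rec_nat (a w f F) (\<lambda>n r. c n r w f F) n # w" f \<Gamma> F] v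
        by simp
    qed
    thus "kleene (list_encode [5, d, e]) (map A0 v @ tail f \<Gamma> F)
        (rec_nat (a (tl v) f F) (\<lambda>n r. c n r (tl v) f F) (hd v))" using v by simp
  qed
qed

section \<open>Arithmetic, Boolean connectives, number quantifiers and search\<close>

lemma computable_pred:
  assumes "computable k a"
  shows "computable k (\<lambda>v f F. a v f F - 1)"
proof -
  have "rec_nat 0 (\<lambda>n r. n) m = m - 1" for m :: nat by (cases m) auto
  with computable_rec[OF assms computable_const[of _ 0] computable_hd] show ?thesis by simp
qed

lemma computable_plus:
  assumes "computable k a" "computable k b"
  shows "computable k (\<lambda>v f F. a v f F + b v f F)"
proof -
  have "rec_nat x (\<lambda>n r. Suc r) y = x + y" for x y by (induction y) auto
  with computable_rec[OF assms(2,1) computable_Suc[OF computable_var(2)]] show ?thesis by simp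
qed

lemma computable_minus:
  assumes "computable k a" "computable k b"
  shows "computable k (\<lambda>v f F. a v f F - b v f F)"
proof -
  have "rec_nat x (\<lambda>n r. r - 1) y = x - y" for x y :: nat by (induction y) auto
  with computable_rec[OF assms(2,1) computable_pred[OF computable_var(2)]] show ?thesis by simp
qed

lemma computable_times:
  assumes "computable k a" "computable k b"
  shows "computable k (\<lambda>v f F. a v f F * b v f F)"
proof -
  have "rec_nat 0 (\<lambda>n r. r + x) y = x * y" for x y :: nat by (induction y) auto
  with computable_rec[OF assms(2) computable_const[of _ 0]
      computable_plus[OF computable_var(2) computable_weaken[OF computable_weaken[OF assms(1)]]]]
  show ?thesis by simp
qed

lemma computable_power:
  assumes "computable k a" "computable k b"
  shows "computable k (\<lambda>v f F. a v f F ^ b v f F)"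
proof -
  have "rec_nat 1 (\<lambda>n r. r * x) y = x ^ y" for x y :: nat by (induction y) auto
  with computable_rec[OF assms(2) computable_const[of _ 1]
      computable_times[OF computable_var(2) computable_weaken[OF computable_weaken[OF assms(1)]]]]
  show ?thesis by simp
qed

lemma computable_mod2:
  assumes "computable k a"
  shows "computable k (\<lambda>v f F. a v f F mod 2)"
proof -
  have "rec_nat 0 (\<lambda>n r. 1 - r) y = y mod 2" for y :: nat by (induction y) (auto simp: mod_Suc)
  with computable_rec[OF assms computable_const[of _ 0]
      computable_minus[OF computable_const[of _ 1] computable_var(2)]]
  show ?thesis by simp
qed

lemma computable_div2:
  assumes "computable k a"
  shows "computable k (\<lambda>v f F. a v f F div 2)"
proof -
  have "rec_nat 0 (\<lambda>n r. r + n mod 2) y = y div 2" for y :: nat by (induction y) (auto, presburger)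
  with computable_rec[OF assms computable_const[of _ 0]
      computable_plus[OF computable_var(2) computable_mod2[OF computable_var(1)]]]
  show ?thesis by simp
qed

lemma computable_eq:
  assumes "computable k a" "computable k b"
  shows "computable k (\<lambda>v f F. of_bool (a v f F = b v f F))"
proof -
  have "of_bool (x = y) = 1 - ((x - y) + (y - x))" for x y :: nat by auto
  with computable_minus[OF computable_const[of _ 1]
    computable_plus[OF computable_minus[OF assms] computable_minus[OF assms(2,1)]]]
  show ?thesis by simp
qed

lemma computable_le:
  assumes "computable k a" "computable k b"
  shows "computable k (\<lambda>v f F. of_bool (a v f F \<le> b v f F))"
proof -
  have "of_bool (x \<le> y) = 1 - (x - y)" for x y :: nat by auto
  with computable_minus[OF computable_const[of _ 1] computable_minus[OF assms]]
  show ?thesis by simp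
qed

lemma computable_less:
  assumes "computable k a" "computable k b"
  shows "computable k (\<lambda>v f F. of_bool (a v f F < b v f F))"
  using computable_le[OF computable_Suc[OF assms(1)] assms(2)] by (simp add: Suc_le_eq)

lemma computable_not:
  assumes "computable k (\<lambda>v f F. of_bool (P v f F))"
  shows "computable k (\<lambda>v f F. of_bool (\<not> P v f F))"
proof -
  have "of_bool (\<not> Q) = (1::nat) - of_bool Q" for Q by simp
  thus ?thesis using computable_minus[OF computable_const[of _ 1] assms] by (simp only:)
qed

lemma computable_conj:
  assumes "computable k (\<lambda>v f F. of_bool (P v f F))" "computable k (\<lambda>v f F. of_bool (Q v f F))"
  shows "computable k (\<lambda>v f F. of_bool (P v f F \<and> Q v f F))"
  using computable_times[OF assms] by (simp add: of_bool_conj)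

lemma computable_disj:
  assumes "computable k (\<lambda>v f F. of_bool (P v f F))" "computable k (\<lambda>v f F. of_bool (Q v f F))"
  shows "computable k (\<lambda>v f F. of_bool (P v f F \<or> Q v f F))"
  using computable_not[OF computable_conj[OF assms[THEN computable_not]]] by simp

lemma computable_imp:
  assumes "computable k (\<lambda>v f F. of_bool (P v f F))" "computable k (\<lambda>v f F. of_bool (Q v f F))"
  shows "computable k (\<lambda>v f F. of_bool (P v f F \<longrightarrow> Q v f F))"
  using computable_disj[OF computable_not[OF assms(1)] assms(2)] unfolding imp_conv_disj .

text \<open>This is where Kleene's quantifier enters. It looks for a zero, so it is applied to the
  truth values of the negation.\<close>

lemma computable_ex:
  assumes "computable (Suc k) (\<lambda>v f F. of_bool (P (hd v) (tl v) f F))"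
  shows "computable k (\<lambda>v f F. of_bool (\<exists>n. P n v f F))"
proof -
  have "of_bool (\<exists>n. P n v f F) = 1 - E2 (\<lambda>n. of_bool (\<not> P n v f F))" for v f F
    by (auto simp: E2_def)
  with computable_minus[OF computable_const[of _ 1]
    computable_E2[of k "\<lambda>n v f F. of_bool (\<not> P n v f F)", OF computable_not[OF assms]]]
  show ?thesis by simp
qed

lemma computable_all:
  assumes "computable (Suc k) (\<lambda>v f F. of_bool (P (hd v) (tl v) f F))"
  shows "computable k (\<lambda>v f F. of_bool (\<forall>n. P n v f F))"
  using computable_not[OF computable_ex[of k "\<lambda>n v f F. \<not> P n v f F", OF computable_not[OF assms]]]
  by simp

text \<open>Both branches are evaluated and weighted by truth values, which is harmless because both
  are total.\<close>

lemma computable_if: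
  assumes "computable k (\<lambda>v f F. of_bool (P v f F))" "computable k a" "computable k b"
  shows "computable k (\<lambda>v f F. if P v f F then a v f F else b v f F)"
proof -
  have "(if P v f F then a v f F else b v f F) =
      of_bool (P v f F) * a v f F + of_bool (\<not> P v f F) * b v f F" for v f F by simp
  with computable_plus[OF computable_times[OF assms(1,2)] computable_times[OF computable_not[OF assms(1)] assms(3)]]
  show ?thesis by simp
qed

lemma computable_case_nat:
  assumes "computable k c" "computable k a" "computable (Suc k) (\<lambda>v f F. b (hd v) (tl v) f F)"
  shows "computable k (\<lambda>v f F. case_nat (a v f F) (\<lambda>n. b n v f F) (c v f F))"
proof -
  have eq: "(\<lambda>v f F. case_nat (a v f F) (\<lambda>n. b n v f F) (c v f F)) =
      (\<lambda>v f F. if c v f F = 0 then a v f F else b (c v f F - 1) v f F)"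
    by (auto simp: fun_eq_iff split: nat.split)
  show ?thesis unfolding eq
    by (rule computable_if[OF computable_eq[OF assms(1) computable_const] assms(2)
      computable_let[OF computable_pred[OF assms(1)] assms(3)]])
qed

text \<open>
  Unbounded search is a recursion through S9: the search program receives its own index as an
  argument.  The branching is on indices, since S5 would evaluate both branches.
\<close>

lemma computable_mu:
  assumes r: "computable (Suc k) (\<lambda>v f F. r (hd v) (tl v) f F)"
    and ex: "\<And>v f F. \<exists>n. r n v f F = (0::nat)"
  shows "computable k (\<lambda>v f F. LEAST n. r n v f F = 0)"
proof -
  let ?nine = "list_encode [9, k + 6]"
  obtain I0 where I0: "\<And>v f \<Gamma> F. length v = Suc (Suc k) \<Longrightarrow>
      kleene I0 (map A0 v @ tail f \<Gamma> F) (hd (tl v))"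
    using computable_var(2)[of k] unfolding computable_def by blast
  \<comment> \<open>The recursive branch: \<open>I1\<close> runs the program with index
    \<open>c\<close> on \<open>c\<close> and \<open>Suc n\<close>, so a program that is handed its
    own index calls itself.\<close>
  obtain I1 where I1: "\<And>c n v f \<Gamma> F m. length v = k \<Longrightarrow>
      kleene c (A0 c # A0 (Suc n) # map A0 v @ tail f \<Gamma> F) m \<Longrightarrow>
      kleene I1 (A0 c # A0 n # map A0 v @ tail f \<Gamma> F) m"
  proof -
    obtain s where s: "\<And>v f \<Gamma> F. length v = Suc (Suc k) \<Longrightarrow>
        kleene s (map A0 v @ tail f \<Gamma> F) (Suc (hd (tl v)))"
      using computable_Suc[OF computable_var(2)[of k]] unfolding computable_def by blast
    let ?d0 = "list_encode [4, ?nine, list_encode [3]]"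
    let ?d1 = "swap_blocks 2 1 (k + 4) 0 ?d0"
    let ?d2 = "swap_blocks 0 1 1 (k + 5) ?d1"
    show thesis
    proof (rule that)
      fix c n v f \<Gamma> F m
      assume v: "length (v :: nat list) = k"
        and k: "kleene c (A0 c # A0 (Suc n) # map A0 v @ tail f \<Gamma> F) m"
      let ?c = "map A0 v @ tail f \<Gamma> F"
      have l: "length ?c = k + 4" using v by (simp add: tail_def)
      \<comment> \<open>The first \<open>c\<close> is the index that S9 runs. It receives
        \<open>k + 6\<close> arguments, namely \<open>c\<close>, \<open>Suc n\<close> and the
        context, so the old value \<open>n\<close> at the end is dropped.\<close>
      have "kleene ?nine (A0 c # A0 c # A0 (Suc n) # ?c @ [A0 n]) m"
        using S9[OF k, of "[A0 n]"] l by (simp add: add.commute)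
      hence "kleene ?d0 ([A0 c, A0 (Suc n)] @ ?c @ [A0 n] @ []) m"
        using S4[OF S3] by simp
      hence "kleene ?d1 ([A0 c, A0 (Suc n)] @ [A0 n] @ ?c @ []) m"
        using l by (intro kleene_swap_blocks) auto
      hence "kleene ?d1 ([] @ [A0 c] @ [A0 (Suc n)] @ (A0 n # ?c)) m" by simp
      hence "kleene ?d2 ([] @ [A0 (Suc n)] @ [A0 c] @ (A0 n # ?c)) m"
        by (rule kleene_swap_blocks[rotated 4]) (use l in auto)
      thus "kleene (list_encode [4, ?d2, s]) (A0 c # A0 n # ?c) m"
        using S4[OF s[of "c # n # v"]] v by simp
    qed
  qed
  have "computable (Suc (Suc k)) (\<lambda>v f F. if r (hd (tl v)) (tl (tl v)) f F = 0 then I0 else I1)"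
    by (intro computable_if computable_eq computable_const computable_weaken[OF r])
  then obtain p where p: "\<And>v f \<Gamma> F. length v = Suc (Suc k) \<Longrightarrow>
      kleene p (map A0 v @ tail f \<Gamma> F) (if r (hd (tl v)) (tl (tl v)) f F = 0 then I0 else I1)"
    unfolding computable_def by blast
  define P where "P = list_encode [4, ?nine, p]"
  have P: "kleene P (A0 c # A0 n # map A0 v @ tail f \<Gamma> F) m"
    if "length v = k"
      "kleene (if r n v f F = 0 then I0 else I1) (A0 c # A0 n # map A0 v @ tail f \<Gamma> F) m"
    for c n v f \<Gamma> F m
  proof -
    have l: "length (A0 c # A0 n # map A0 v @ tail f \<Gamma> F) = k + 6"
      using that(1) by (simp add: tail_def)
    from S9[OF that(2), of "[]", unfolded l append_Nil2]
    have "kleene ?nine (A0 (if r n v f F = 0 then I0 else I1) # A0 c # A0 n # map A0 v @ tail f \<Gamma> F) m" .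
    with S4[OF p[of "c # n # v" f \<Gamma> F]] that(1) show ?thesis unfolding P_def by simp
  qed
  let ?P1 = "list_encode [4, P, list_encode [2, P]]"
  let ?P0 = "list_encode [4, ?P1, list_encode [2, 0]]"
  show ?thesis
  proof (rule computableI)
    fix v :: "nat list" and f \<Gamma> F
    assume v: "length v = k"
    define N where "N = (LEAST n. r n v f F = 0)"
    have N: "r N v f F = 0" unfolding N_def by (rule LeastI_ex) (rule ex)
    have less: "r n v f F \<noteq> 0" if "n < N" for n using not_less_Least that unfolding N_def by blast
    \<comment> \<open>Induction downwards from the least zero \<open>N\<close>: the call at
      \<open>n\<close> reduces to the call at \<open>Suc n\<close>.\<close>
    have "kleene P (A0 P # A0 n # map A0 v @ tail f \<Gamma> F) N" if "n \<le> N" for n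
      using that
    proof (induction n rule: inc_induct)
      case base
      show ?case using I0[of "P # N # v" f \<Gamma> F] v N by (intro P) auto
    next
      case (step n)
      show ?case using I1[OF v step.IH] v less[OF step.hyps(2)] by (intro P) auto
    qed
    from this[of 0] have "kleene ?P0 (map A0 v @ tail f \<Gamma> F) N"
      by (intro S4[OF S2]) auto
    thus "kleene ?P0 (map A0 v @ tail f \<Gamma> F) (LEAST n. r n v f F = 0)"
      unfolding N_def .
  qed
qed

text \<open>The guard makes the search total: if no number satisfies \<open>P\<close>, it stops at
  0.\<close>

lemma computable_Least:
  assumes "computable (Suc k) (\<lambda>v f F. of_bool (P (hd v) (tl v) f F))"
  shows "computable k (\<lambda>v f F. LEAST n. (\<exists>m. P m v f F) \<longrightarrow> P n v f F)"
proof -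
  have "computable (Suc k) (\<lambda>v f F. of_bool (\<not> ((\<exists>m. P m (tl v) f F) \<longrightarrow> P (hd v) (tl v) f F)))"
    by (intro computable_not computable_imp computable_weaken[OF computable_ex] assms)
  hence "computable k (\<lambda>v f F. LEAST n. of_bool (\<not> ((\<exists>m. P m v f F) \<longrightarrow> P n v f F)) = (0::nat))"
    by (rule computable_mu) auto
  thus ?thesis unfolding of_bool_eq_0_iff not_not .
qed

text \<open>The one oracle call is an S8 step with the oracle in front. As the oracle may be
  partial, all that is asked is that it be defined at the query.\<close>

lemma computed_eq:
  assumes "computable 0 (\<lambda>v f F. H F f)"
  shows "\<exists>e. \<forall>(\<Gamma> :: ptp3) F m. \<Gamma> (H F) = Some m \<longrightarrow> computed e \<Gamma> F = Some m"
proof -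
  from assms obtain d where d: "\<And>f \<Gamma> F. kleene d (tail f \<Gamma> F) (H F f)"
    unfolding computable_def by auto
  show ?thesis
  proof (intro exI allI impI)
    fix \<Gamma> :: ptp3 and F m assume "\<Gamma> (H F) = Some m"
    with d have "kleene (list_encode [8, d]) ([] @ [A3 \<Gamma>, A2 E2] @ [A2 F] @ []) m"
      by (auto simp: tail_def intro: S8_3)
    hence "kleene (swap_blocks 0 1 2 0 (list_encode [8, d])) ([] @ [A2 F] @ [A3 \<Gamma>, A2 E2] @ []) m"
      by (intro kleene_swap_blocks) auto
    hence *: "kleene (swap_blocks 0 1 2 0 (list_encode [8, d])) [A2 F, A3 \<Gamma>, A2 E2] m" by simp
    moreover have "(THE m. kleene (swap_blocks 0 1 2 0 (list_encode [8, d])) [A2 F, A3 \<Gamma>, A2 E2] m) = m"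
      using * by (rule the_equality) (rule kleene_functional[OF _ *])
    ultimately show "computed (swap_blocks 0 1 2 0 (list_encode [8, d])) \<Gamma> F = Some m"
      unfolding computed_def by auto
  qed
qed

subsection \<open>Rational and dyadic approximation of coded reals\<close>

lemmas computable_intros = computable_const computable_var computable_Suc computable_app1
  computable_app2 computable_plus computable_minus computable_times computable_power
  computable_div2 computable_mod2 computable_eq computable_le computable_less computable_not
  computable_conj computable_disj computable_imp computable_ex computable_all computable_if
  computable_case_nat computable_Least

text \<open>Weakening under a binder: the number to be dropped stands behind the bound one, so the
  two are exchanged before weakening.\<close>

lemma computable_weaken2:
  assumes "computable (Suc k) (\<lambda>v f F. \<phi> (hd v) (tl v) f F)"
  shows "computable (Suc (Suc k)) (\<lambda>v f F. \<phi> (hd v) (tl (tl v)) f F)"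
proof -
  from computable_weaken[OF assms] obtain d where d: "\<And>v f \<Gamma> F. length v = Suc (Suc k) \<Longrightarrow>
    kleene d (map A0 v @ tail f \<Gamma> F) (\<phi> (hd (tl v)) (tl (tl v)) f F)" unfolding computable_def by blast
  show ?thesis
  proof (rule computableI)
    fix v :: "nat list" and f \<Gamma> F
    assume "length v = Suc (Suc k)"
    then obtain n x w where v: "v = n # x # w" "length w = k" by (auto simp: length_Suc_conv)
    let ?c = "map A0 w @ tail f \<Gamma> F"
    have "kleene d ([] @ [A0 x] @ [A0 n] @ ?c) (\<phi> n w f F)" using d[of "x # n # w" f \<Gamma> F] v by simp
    hence "kleene (swap_blocks 0 1 1 (k + 4) d) ([] @ [A0 n] @ [A0 x] @ ?c) (\<phi> n w f F)"
      using v by (intro kleene_swap_blocks) (auto simp: tail_def)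
    thus "kleene (swap_blocks 0 1 1 (k + 4) d) (map A0 v @ tail f \<Gamma> F) (\<phi> (hd v) (tl (tl v)) f F)"
      using v by simp
  qed
qed

lemma computable_even:
  assumes "computable k a"
  shows "computable k (\<lambda>v f F. of_bool (even (a v f F)))"
  unfolding even_iff_mod_2_eq_zero by (intro computable_intros assms)

lemma computable_iff:
  assumes "computable k (\<lambda>v f F. of_bool (P v f F))" "computable k (\<lambda>v f F. of_bool (Q v f F))"
  shows "computable k (\<lambda>v f F. of_bool (P v f F \<longleftrightarrow> Q v f F))"
  unfolding iff_conv_conj_imp by (intro computable_intros assms)

lemma computable_prod_encode:
  assumes "computable k a" "computable k b"
  shows "computable k (\<lambda>v f F. prod_encode (a v f F, b v f F))"
  unfolding prod_encode_def triangle_def prod.case by (intro computable_intros assms)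

text \<open>Decoding is a search for the first component. Surjectivity of \<open>prod_encode\<close>
  makes the guard true, and injectivity makes the result unique.\<close>

lemma computable_fst_prod_decode:
  assumes "computable k a"
  shows "computable k (\<lambda>v f F. fst (prod_decode (a v f F)))"
proof -
  have "(LEAST x. (\<exists>m y. c = prod_encode (m, y)) \<longrightarrow> (\<exists>y. c = prod_encode (x, y))) = fst (prod_decode c)" for c
  proof (rule Least_equality)
    show "(\<exists>m y. c = prod_encode (m, y)) \<longrightarrow> (\<exists>y. c = prod_encode (fst (prod_decode c), y))"
      by (metis prod.collapse prod_decode_inverse)
  next
    fix x assume "(\<exists>m y. c = prod_encode (m, y)) \<longrightarrow> (\<exists>y. c = prod_encode (x, y))"
    then obtain y where "c = prod_encode (x, y)" by (metis prod.collapse prod_decode_inverse)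
    thus "fst (prod_decode c) \<le> x" by simp
  qed
  moreover have "computable k (\<lambda>v f F. LEAST x. (\<exists>m y. a v f F = prod_encode (m, y)) \<longrightarrow>
      (\<exists>y. a v f F = prod_encode (x, y)))"
    by (intro computable_intros computable_prod_encode
      computable_weaken[OF computable_weaken[OF assms]])
  ultimately show ?thesis by simp
qed

lemma computable_snd_prod_decode:
  assumes "computable k a"
  shows "computable k (\<lambda>v f F. snd (prod_decode (a v f F)))"
proof -
  have "(LEAST x. (\<exists>m y. c = prod_encode (y, m)) \<longrightarrow> (\<exists>y. c = prod_encode (y, x))) = snd (prod_decode c)" for c
  proof (rule Least_equality)
    show "(\<exists>m y. c = prod_encode (y, m)) \<longrightarrow> (\<exists>y. c = prod_encode (y, snd (prod_decode c)))"
      by (metis prod.collapse prod_decode_inverse)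
  next
    fix x assume "(\<exists>m y. c = prod_encode (y, m)) \<longrightarrow> (\<exists>y. c = prod_encode (y, x))"
    then obtain y where "c = prod_encode (y, x)" by (metis prod.collapse prod_decode_inverse)
    thus "snd (prod_decode c) \<le> x" by simp
  qed
  moreover have "computable k (\<lambda>v f F. LEAST x. (\<exists>m y. a v f F = prod_encode (y, m)) \<longrightarrow>
      (\<exists>y. a v f F = prod_encode (y, x)))"
    by (intro computable_intros computable_prod_encode
      computable_weaken[OF computable_weaken[OF assms]])
  ultimately show ?thesis by simp
qed

section \<open>Comparison of coded reals with dyadic rationals\<close>

abbreviation real_code :: "nat \<Rightarrow> real" where
  "real_code c \<equiv> real_of_rat (nat_to_rat_surj c)"

text \<open>For a code \<open>r\<close> of x this is |x - a/2^l| < 2^-j (\<open>near_iff\<close>).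
  The term \<open>1 / 2 ^ N\<close> bounds the error of the N-th approximation, so strict inequality
  of reals becomes one number quantifier, which \<open>E2\<close> decides.\<close>

definition near :: "tp1 \<Rightarrow> nat \<Rightarrow> nat \<Rightarrow> nat \<Rightarrow> bool" where
  "near r a l j \<longleftrightarrow> (\<exists>N. \<bar>real_code (r N) - a / 2 ^ l\<bar> + 1 / 2 ^ N < 1 / 2 ^ j)"

lemma int_decode_alt:
  "int_decode u = (if even u then 1 else - 1) * int ((u + 1) div 2)"
  by (auto simp: int_decode_def sum_decode_def elim!: evenE oddE)

text \<open>Sign, numerator and denominator are separated so that only natural numbers remain to be
  computed with. For \<open>w = 0\<close> the fraction has denominator 0 and hence value 0; it is
  written as 0/1 to keep the denominator positive.\<close>

lemma real_code_eq:
  fixes c :: nat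
  defines "u \<equiv> fst (prod_decode c)" and "w \<equiv> snd (prod_decode c)"
  shows "real_code c = (if even u \<longleftrightarrow> even w then 1 else - 1) *
    real (if w = 0 then 0 else (u + 1) div 2) / real (if w = 0 then 1 else (w + 1) div 2)"
proof -
  have "nat_to_rat_surj c = Fract (int_decode u) (int_decode w)"
    by (simp add: nat_to_rat_surj_def u_def w_def split: prod.split)
  also have "\<dots> = of_int (int_decode u) / of_int (int_decode w)"
    by (simp add: Fract_of_int_quotient)
  finally have "real_code c = of_int (int_decode u) / of_int (int_decode w)"
    by (simp add: of_rat_divide)
  thus ?thesis unfolding int_decode_alt by (auto simp: divide_simps algebra_simps)
qed

text \<open>Multiplication by \<open>B * 2 ^ l * 2 ^ N * 2 ^ j\<close> clears all denominators. For
  equal signs the absolute difference is the sum of the two truncated differences, one of which is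
  0.\<close>

lemma near_step_iff:
  fixes a l N j A B :: nat and pos :: bool
  assumes "B > 0"
  shows "\<bar>(if pos then 1 else - 1) * real A / real B - a / 2 ^ l\<bar> + 1 / 2 ^ N < 1 / 2 ^ j \<longleftrightarrow>
    (if pos then (A * 2 ^ l - a * B) + (a * B - A * 2 ^ l) else A * 2 ^ l + a * B) * 2 ^ (N + j) +
      B * 2 ^ (l + j) < B * 2 ^ (l + N)"
    (is "?L < ?R \<longleftrightarrow> ?m < ?n")
proof -
  let ?s = "(if pos then 1 else - 1) :: real"
  let ?d = "if pos then (A * 2 ^ l - a * B) + (a * B - A * 2 ^ l) else A * 2 ^ l + a * B"
  let ?K = "real B * 2 ^ l * 2 ^ N * 2 ^ j"
  have K: "?K > 0" using assms by simp
  have "?s * real A / real B - a / 2 ^ l = (?s * real A * 2 ^ l - a * B) / (real B * 2 ^ l)"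
    using assms by (simp add: field_simps)
  also have "\<bar>\<dots>\<bar> = \<bar>?s * real A * 2 ^ l - a * B\<bar> / (real B * 2 ^ l)"
    using assms by (simp add: abs_mult)
  also have "\<bar>?s * real A * 2 ^ l - a * B\<bar> = real ?d"
  proof (cases pos)
    case True
    show ?thesis
    proof (cases "a * B \<le> A * 2 ^ l")
      case le: True
      hence "real a * real B \<le> real A * 2 ^ l"
        by (metis of_nat_le_iff of_nat_mult of_nat_numeral of_nat_power)
      thus ?thesis using True le by (simp add: of_nat_diff)
    next
      case le: False
      hence le': "A * 2 ^ l \<le> a * B" by simp
      hence "real A * 2 ^ l \<le> real a * real B"
        by (metis of_nat_le_iff of_nat_mult of_nat_numeral of_nat_power)
      thus ?thesis using True le' by (simp add: of_nat_diff)
    qed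
  next
    case False
    have "0 \<le> real A * 2 ^ l" "0 \<le> real a * real B" by simp_all
    hence "\<bar>- (real A * 2 ^ l) - real a * real B\<bar> = real A * 2 ^ l + real a * real B" by linarith
    thus ?thesis using False by simp
  qed
  finally have L: "?L = real ?d / (real B * 2 ^ l) + 1 / 2 ^ N" by simp
  have "?L < ?R \<longleftrightarrow> ?L * ?K < ?R * ?K" by (rule mult_less_cancel_right_pos[OF K, symmetric])
  also have "?L * ?K = real ?m"
    unfolding L using assms by (simp add: field_simps power_add del: of_nat_diff)
  also have "?R * ?K = real ?n"
    using assms by (simp add: field_simps power_add)
  finally show ?thesis by (simp only: of_nat_less_iff)
qed

lemma computable_near:
  assumes "computable (Suc k) (\<lambda>v f F. r (hd v) (tl v) f F)"
    "computable k a" "computable k l" "computable k j"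
  shows "computable k (\<lambda>v f F. of_bool (near (\<lambda>n. r n v f F) (a v f F) (l v f F) (j v f F)))"
proof -
  have "computable (Suc k) (\<lambda>v f F. of_bool (\<bar>real_code (r (hd v) (tl v) f F) -
      a (tl v) f F / 2 ^ l (tl v) f F\<bar> + 1 / 2 ^ hd v < 1 / 2 ^ j (tl v) f F))"
    unfolding real_code_eq
    by (subst near_step_iff)
      (auto simp del: of_bool_less_eq_iff intro!: computable_intros computable_even computable_iff
        computable_fst_prod_decode computable_snd_prod_decode assms(1) assms(2-4)[THEN computable_weaken])
  thus ?thesis unfolding near_def by (rule computable_ex)
qed

text \<open>An even number \<open>2 * a\<close> decodes to the integer \<open>a\<close>, so the
  coded fraction has numerator \<open>a\<close> and denominator \<open>2 ^ l\<close>.\<close>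

definition rat_code :: "nat \<Rightarrow> nat \<Rightarrow> nat" where
  "rat_code a l = prod_encode (2 * a, 2 * 2 ^ l)"

lemma real_code_rat_code [simp]: "real_code (rat_code a l) = a / 2 ^ l"
  unfolding real_code_eq rat_code_def by simp

lemma computable_rat_code:
  assumes "computable k a" "computable k l"
  shows "computable k (\<lambda>v f F. rat_code (a v f F) (l v f F))"
  unfolding rat_code_def by (intro computable_intros computable_prod_encode assms)

lemma codes_real_const: "real_code c = x \<Longrightarrow> codes_real (\<lambda>_. c) x"
  by (simp add: codes_real_def)

lemma codes_real_dist:
  assumes "codes_real r x"
  shows "\<bar>real_code (r N) - x\<bar> \<le> 1 / 2 ^ N"
proof (rule LIMSEQ_le_const2)
  have "(\<lambda>n. real_code (r n)) \<longlonglongrightarrow> x" using assms by (simp add: codes_real_def)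
  thus "(\<lambda>n. \<bar>real_code (r N) - real_code (r n)\<bar>) \<longlonglongrightarrow> \<bar>real_code (r N) - x\<bar>"
    by (intro tendsto_intros)
  show "\<exists>M. \<forall>n\<ge>M. \<bar>real_code (r N) - real_code (r n)\<bar> \<le> 1 / 2 ^ N"
  proof (intro exI[of _ N] allI impI)
    fix n assume "n \<ge> N"
    then obtain i where n: "n = N + i" using le_Suc_ex by blast
    have "\<bar>nat_to_rat_surj (r N) - nat_to_rat_surj (r n)\<bar> \<le> 1 / 2 ^ N"
      using assms unfolding codes_real_def n by (simp add: less_imp_le)
    hence "real_of_rat \<bar>nat_to_rat_surj (r N) - nat_to_rat_surj (r n)\<bar> \<le> real_of_rat (1 / 2 ^ N)"
      by (simp only: of_rat_less_eq)
    thus "\<bar>real_code (r N) - real_code (r n)\<bar> \<le> 1 / 2 ^ N"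
      by (simp add: of_rat_divide of_rat_power flip: of_rat_diff)
  qed
qed

lemma near_iff:
  assumes "codes_real r x"
  shows "near r a l j \<longleftrightarrow> \<bar>x - a / 2 ^ l\<bar> < 1 / 2 ^ j"
proof
  assume "near r a l j"
  then obtain N where "\<bar>real_code (r N) - a / 2 ^ l\<bar> + 1 / 2 ^ N < 1 / 2 ^ j"
    unfolding near_def by blast
  with codes_real_dist[OF assms, of N] show "\<bar>x - a / 2 ^ l\<bar> < 1 / 2 ^ j" by linarith
next
  assume less: "\<bar>x - a / 2 ^ l\<bar> < 1 / 2 ^ j"
  have "(\<lambda>N. (1 / 2) ^ N :: real) \<longlonglongrightarrow> 0" by (rule LIMSEQ_realpow_zero) auto
  \<comment> \<open>Half of the slack, because \<open>1 / 2 ^ N\<close> is spent twice: on the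
    distance of \<open>r N\<close> from \<open>x\<close> and on the summand in
    \<open>near\<close>.\<close>
  moreover have "(1 / 2 ^ j - \<bar>x - a / 2 ^ l\<bar>) / 2 > 0" using less by simp
  ultimately have "\<forall>\<^sub>F N in sequentially. (1 / 2) ^ N < (1 / 2 ^ j - \<bar>x - a / 2 ^ l\<bar>) / 2"
    by (rule order_tendstoD)
  then obtain N where "(1 / 2) ^ N < (1 / 2 ^ j - \<bar>x - a / 2 ^ l\<bar>) / 2"
    by (auto simp: eventually_sequentially)
  hence "1 / 2 ^ N + 1 / 2 ^ N < 1 / 2 ^ j - \<bar>x - a / 2 ^ l\<bar>" by (simp add: power_one_over field_simps)
  with codes_real_dist[OF assms, of N] have "\<bar>real_code (r N) - a / 2 ^ l\<bar> + 1 / 2 ^ N < 1 / 2 ^ j"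
    by linarith
  thus "near r a l j" unfolding near_def by blast
qed

text \<open>
  In the two queries, \<open>F\<close> is a tuple of inputs; \<open>F (\<lambda>_. 0)\<close> is the number argument of the
  output, which is passed on.
\<close>

definition cont_query :: "tp2 \<Rightarrow> tp2" where
  "cont_query F h =
    (if h 0 = 0 then F (\<lambda>_. 0)
     else if h 0 = 1 then
       of_bool ((F (case_nat 1 (\<lambda>i. h (Suc (Suc i)))) = 1 \<longrightarrow> h 1 < F (case_nat 2 (\<lambda>i. h (Suc (Suc i))))) \<and>
         near (\<lambda>n. F (case_nat 4 (case_nat n (\<lambda>i. h (Suc (Suc i)))))) 0 0 (h 1))
     else 0)"

lemma computable_cont_query: "computable 0 (\<lambda>v f F. cont_query F f)"
  unfolding cont_query_def by (intro computable_intros computable_near)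

text \<open>Component 0 of the input tuple is the number argument, so the joined sequence of sets is
  component 1 and \<open>query F i\<close> is its i-th member (\<open>query_tuple\<close>).\<close>

definition query :: "tp2 \<Rightarrow> nat \<Rightarrow> tp2" where
  "query F i q = F (case_nat 1 (case_nat i q))"

lemma computable_query:
  assumes "computable k a" "computable (Suc k) (\<lambda>v f F. q (hd v) (tl v) f F)"
  shows "computable k (\<lambda>v f F. query F (a v f F) (\<lambda>n. q n v f F))"
  unfolding query_def
  by (intro computable_intros computable_weaken[OF assms(1)] computable_weaken2 assms)

text \<open>
  The dyadic rational \<open>odd_num t / 2 ^ exponent i t\<close> is in lowest terms and its exponent
  determines \<open>i\<close>, so that different \<open>i\<close> never pick the same point.
\<close>

definition odd_num :: "nat \<Rightarrow> nat" where
  "odd_num t = 2 * fst (prod_decode t) + 1"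

definition exponent :: "nat \<Rightarrow> nat \<Rightarrow> nat" where
  "exponent i t = prod_encode (i, snd (prod_decode t))"

text \<open>With \<open>i\<close> coding (c, k), the i-th basic interval has centre c/2^k and radius
  2^-k. If c > 2^k the centre lies outside [0,1] and no condition is imposed.\<close>

definition good :: "(nat \<Rightarrow> tp2) \<Rightarrow> nat \<Rightarrow> nat \<Rightarrow> bool" where
  "good J i t \<longleftrightarrow> odd_num t \<le> 2 ^ exponent i t \<and>
    (\<forall>j. j \<le> i \<longrightarrow> J j (\<lambda>_. rat_code (odd_num t) (exponent i t)) = 1) \<and>
    (fst (prod_decode i) \<le> 2 ^ snd (prod_decode i) \<longrightarrow>
      near (\<lambda>_. rat_code (odd_num t) (exponent i t)) (fst (prod_decode i)) (snd (prod_decode i)) (snd (prod_decode i)))"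

definition pick :: "(nat \<Rightarrow> tp2) \<Rightarrow> nat \<Rightarrow> nat" where
  "pick J i = (LEAST t. (\<exists>s. good J i s) \<longrightarrow> good J i t)"

definition near_pick :: "(nat \<Rightarrow> tp2) \<Rightarrow> tp1 \<Rightarrow> nat \<Rightarrow> nat \<Rightarrow> bool" where
  "near_pick J q i j \<longleftrightarrow> near q (odd_num (pick J i)) (exponent i (pick J i)) j"

definition is_pick :: "(nat \<Rightarrow> tp2) \<Rightarrow> tp1 \<Rightarrow> nat \<Rightarrow> bool" where
  "is_pick J q i \<longleftrightarrow> (\<forall>j. near_pick J q i j)"

text \<open>With \<open>k\<close> coding a pair (m, j), this is membership in the closed set that
  belongs to (m, j), decided from a code \<open>q\<close> of the point.\<close>

definition bad :: "(nat \<Rightarrow> tp2) \<Rightarrow> tp1 \<Rightarrow> nat \<Rightarrow> bool" where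
  "bad J q k \<longleftrightarrow> J (fst (prod_decode k)) q \<noteq> 1 \<and>
    (\<forall>i. i < fst (prod_decode k) \<longrightarrow> \<not> near_pick J q i (snd (prod_decode k)))"

definition pick_index :: "(nat \<Rightarrow> tp2) \<Rightarrow> tp1 \<Rightarrow> nat" where
  "pick_index J q = (LEAST i. (\<exists>j. is_pick J q j) \<longrightarrow> is_pick J q i)"

text \<open>The values of the constructed function are 0 and powers of 1/2, so a single rational
  code suffices. The number 0 decodes to the fraction 0/0, which is 0.\<close>

definition bad_code :: "(nat \<Rightarrow> tp2) \<Rightarrow> tp1 \<Rightarrow> nat" where
  "bad_code J q = (if \<exists>k. bad J q k then rat_code 1 (LEAST k. (\<exists>l. bad J q l) \<longrightarrow> bad J q k) else 0)"

text \<open>Components 3 and 4 agree because the function is its own oscillation function. They skip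
  the entry \<open>h 1\<close>, the index into the Cauchy sequence, since the values are coded by
  constant sequences.\<close>

definition baire_query :: "tp2 \<Rightarrow> tp2" where
  "baire_query F h =
    (if h 0 = 0 then F (\<lambda>_. 0)
     else if h 0 = 1 then of_bool (\<exists>i. is_pick (query F) (\<lambda>n. h (Suc n)) i)
     else if h 0 = 2 then pick_index (query F) (\<lambda>n. h (Suc n))
     else if h 0 = 3 \<or> h 0 = 4 then bad_code (query F) (\<lambda>n. h (Suc (Suc n)))
     else 0)"

lemmas computable_prod_intros = computable_prod_encode computable_fst_prod_decode
  computable_snd_prod_decode computable_rat_code computable_near computable_query

lemma computable_odd_num:
  assumes "computable k t"
  shows "computable k (\<lambda>v f F. odd_num (t v f F))"
  unfolding odd_num_def by (intro computable_intros computable_prod_intros assms)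

lemma computable_exponent:
  assumes "computable k i" "computable k t"
  shows "computable k (\<lambda>v f F. exponent (i v f F) (t v f F))"
  unfolding exponent_def by (intro computable_intros computable_prod_intros assms)

lemma computable_pick:
  assumes "computable k i"
  shows "computable k (\<lambda>v f F. pick (query F) (i v f F))"
  unfolding pick_def good_def
  by (intro computable_intros computable_prod_intros computable_odd_num computable_exponent
    assms assms[THEN computable_weaken] assms[THEN computable_weaken, THEN computable_weaken]
    assms[THEN computable_weaken, THEN computable_weaken, THEN computable_weaken])

lemma computable_near_pick:
  assumes "computable (Suc k) (\<lambda>v f F. q (hd v) (tl v) f F)" "computable k i" "computable k j"
  shows "computable k (\<lambda>v f F. of_bool (near_pick (query F) (\<lambda>n. q n v f F) (i v f F) (j v f F)))"
  unfolding near_pick_def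
  by (intro computable_near computable_odd_num computable_exponent computable_pick assms)

lemma computable_is_pick:
  assumes "computable (Suc k) (\<lambda>v f F. q (hd v) (tl v) f F)" "computable k i"
  shows "computable k (\<lambda>v f F. of_bool (is_pick (query F) (\<lambda>n. q n v f F) (i v f F)))"
  unfolding is_pick_def
  by (intro computable_intros computable_near_pick computable_weaken2 assms
    assms(2)[THEN computable_weaken])

lemma computable_bad:
  assumes "computable (Suc k) (\<lambda>v f F. q (hd v) (tl v) f F)" "computable k i"
  shows "computable k (\<lambda>v f F. of_bool (bad (query F) (\<lambda>n. q n v f F) (i v f F)))"
  unfolding bad_def
  by (intro computable_intros computable_prod_intros computable_near_pick computable_weaken2 assms
    assms(2)[THEN computable_weaken])

lemma computable_baire_query: "computable 0 (\<lambda>v f F. baire_query F f)"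
  unfolding baire_query_def pick_index_def bad_code_def
  by (intro computable_intros computable_is_pick computable_bad computable_rat_code)

subsection \<open>Oscillation and Baire 1 functions\<close>

lemma subset_closure_unit_iff:
  assumes "U \<subseteq> {0..1::real}"
  shows "{0..1} \<subseteq> closure U \<longleftrightarrow> (\<forall>a b. 0 \<le> a \<longrightarrow> a < b \<longrightarrow> b \<le> 1 \<longrightarrow> (\<exists>x\<in>U. a < x \<and> x < b))"
proof (intro iffI allI impI)
  fix a b :: real
  assume cl: "{0..1} \<subseteq> closure U" and ab: "0 \<le> a" "a < b" "b \<le> 1"
  have "(a + b) / 2 \<in> {0..1}" "(a + b) / 2 \<in> {a<..<b}" using ab by (auto simp: field_simps)
  hence "(a + b) / 2 \<in> {a<..<b} \<inter> closure U" using cl by blast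
  hence "{a<..<b} \<inter> U \<noteq> {}" using open_Int_closure_eq_empty[OF open_greaterThanLessThan, of a b U] by blast
  thus "\<exists>x\<in>U. a < x \<and> x < b" by auto
next
  assume dense: "\<forall>a b. 0 \<le> a \<longrightarrow> a < b \<longrightarrow> b \<le> 1 \<longrightarrow> (\<exists>x\<in>U. a < x \<and> x < b)"
  show "{0..1} \<subseteq> closure U"
  proof
    fix x :: real assume x: "x \<in> {0..1}"
    show "x \<in> closure U"
    proof (subst closure_approachable, intro allI impI)
      fix e :: real assume "e > 0"
      \<comment> \<open>Clipping to [0,1] treats the end points like all other points.\<close>
      hence "max 0 (x - e) < min 1 (x + e)" using x by auto
      then obtain y where "y \<in> U" "max 0 (x - e) < y" "y < min 1 (x + e)"
        using dense[rule_format, of "max 0 (x - e)" "min 1 (x + e)"] by (metis max.cobounded1 min.cobounded1)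
      thus "\<exists>y\<in>U. dist y x < e" by (intro bexI[of _ y]) (auto simp: dist_real_def)
    qed
  qed
qed

lemma openin_unit_iff:
  "openin (top_of_set {0..1::real}) U \<longleftrightarrow>
    U \<subseteq> {0..1} \<and> (\<forall>x\<in>U. \<exists>r>0. \<forall>y\<in>{0..1}. \<bar>y - x\<bar> < r \<longrightarrow> y \<in> U)"
  unfolding openin_euclidean_subtopology_iff dist_real_def ..

lemma osc_on_mono: "A \<subseteq> B \<Longrightarrow> osc_on f A \<le> osc_on f B"
  unfolding osc_on_def by (intro ereal_minus_mono SUP_subset_mono INF_superset_mono) auto

lemma osc_on_ge: "x \<in> A \<Longrightarrow> y \<in> A \<Longrightarrow> ereal (f x - f y) \<le> osc_on f A"
  unfolding osc_on_def ereal_minus(1)[symmetric]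
  by (intro ereal_minus_mono SUP_upper INF_lower)

text \<open>The extended real difference is bounded after both extrema are seen to be finite: each
  is squeezed between reals by means of the point \<open>x0\<close>.\<close>

lemma osc_on_le:
  assumes "A \<noteq> {}" and le: "\<And>x y. x \<in> A \<Longrightarrow> y \<in> A \<Longrightarrow> f x \<le> f y + e"
  shows "osc_on f A \<le> ereal e"
proof -
  obtain x0 where x0: "x0 \<in> A" using assms by blast
  let ?S = "SUP x\<in>A. ereal (f x)" and ?I = "INF x\<in>A. ereal (f x)"
  have S: "?S \<le> ereal (f y + e)" if "y \<in> A" for y using le that by (intro SUP_least) auto
  have "ereal (f x0) \<le> ?S" using x0 by (rule SUP_upper)
  with S[OF x0] obtain s where s: "?S = ereal s" by (cases ?S) auto
  have "ereal (s - e) \<le> ?I" using S unfolding s by (intro INF_greatest) (auto simp: diff_le_eq)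
  moreover have "?I \<le> ereal (f x0)" using x0 by (rule INF_lower)
  ultimately obtain i where i: "?I = ereal i" "s - e \<le> i" by (cases ?I) auto
  show ?thesis unfolding osc_on_def s i using i by simp
qed

text \<open>The balls shrink with \<open>k\<close>, so the limit is an infimum, and smallness of the
  oscillation at a point is witnessed by a single ball.\<close>

lemma osc_eq_INF: "osc f x = (INF k. osc_on f (ball x (1 / 2 ^ k) \<inter> {0..1}))"
proof -
  have "decseq (\<lambda>k. osc_on f (ball x (1 / 2 ^ k) \<inter> {0..1}))"
  proof (rule decseq_SucI, rule osc_on_mono)
    fix k
    have "(1::real) / 2 ^ Suc k \<le> 1 / 2 ^ k" by (simp add: field_simps)
    thus "ball x (1 / 2 ^ Suc k) \<inter> {0..1} \<subseteq> ball x (1 / 2 ^ k) \<inter> {0..1}"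
      using subset_ball by blast
  qed
  from LIMSEQ_INF[OF this] show ?thesis unfolding osc_def by (rule limI)
qed

lemma osc_less_iff: "osc f x < e \<longleftrightarrow> (\<exists>k. osc_on f (ball x (1 / 2 ^ k) \<inter> {0..1}) < e)"
  unfolding osc_eq_INF by (auto simp: INF_less_iff)

lemma osc_nonneg: "x \<in> {0..1} \<Longrightarrow> 0 \<le> osc f x"
  unfolding osc_eq_INF using osc_on_ge[of x _ x f] by (intro INF_greatest) (auto simp: zero_ereal_def)

lemma ex_inverse_power_less: "(0::real) < e \<Longrightarrow> \<exists>k. 1 / 2 ^ k < e"
  using real_arch_pow_inv[of e "1/2"] by (auto simp: power_one_over)

text \<open>A witnessing ball about \<open>x\<close> contains the ball of half its radius about
  every point closer to \<open>x\<close> than this half.\<close>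

lemma openin_osc_less: "openin (top_of_set {0..1}) {x \<in> {0..1}. osc f x < e}"
proof -
  have "\<exists>r>0. \<forall>y\<in>{0..1}. \<bar>y - x\<bar> < r \<longrightarrow> osc f y < e" if less: "osc f x < e" for x
  proof -
    from less obtain k where k: "osc_on f (ball x (1 / 2 ^ k) \<inter> {0..1}) < e"
      unfolding osc_less_iff by blast
    have "osc f y < e" if "\<bar>y - x\<bar> < 1 / 2 ^ Suc k" for y
    proof -
      have "z \<in> ball x (1 / 2 ^ k)" if z: "z \<in> ball y (1 / 2 ^ Suc k)" for z
      proof -
        have "(1::real) / 2 ^ k = 1 / 2 ^ Suc k + 1 / 2 ^ Suc k" by (simp add: field_simps)
        thus ?thesis using z \<open>\<bar>y - x\<bar> < _\<close> unfolding mem_ball dist_real_def by linarith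
      qed
      hence "ball y (1 / 2 ^ Suc k) \<inter> {0..1} \<subseteq> ball x (1 / 2 ^ k) \<inter> {0..1}" by blast
      from le_less_trans[OF osc_on_mono[OF this] k] show ?thesis unfolding osc_less_iff by blast
    qed
    thus ?thesis by (intro exI[of _ "1 / 2 ^ Suc k"]) auto
  qed
  thus ?thesis unfolding openin_unit_iff by auto
qed

lemma continuous_if_osc_le_0:
  assumes "x \<in> {0..1}" "osc f x \<le> 0"
  shows "continuous (at x within {0..1}) f"
  unfolding continuous_within_eps_delta
proof (intro allI impI)
  fix e :: real assume "e > 0"
  with assms(2) have "osc f x < ereal e" by (simp add: le_less_trans)
  then obtain k where k: "osc_on f (ball x (1 / 2 ^ k) \<inter> {0..1}) < ereal e"
    unfolding osc_less_iff by blast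
  show "\<exists>d>0. \<forall>y\<in>{0..1}. dist y x < d \<longrightarrow> dist (f y) (f x) < e"
  proof (intro exI[of _ "1 / 2 ^ k"] conjI ballI impI)
    fix y :: real assume y: "y \<in> {0..1}" "dist y x < 1 / 2 ^ k"
    let ?A = "ball x (1 / 2 ^ k) \<inter> {0..1}"
    have "y \<in> ?A" "x \<in> ?A" using y assms(1) by (auto simp: dist_commute)
    from osc_on_ge[OF this, of f, THEN le_less_trans, OF k]
      osc_on_ge[OF this(2,1), of f, THEN le_less_trans, OF k]
    show "dist (f y) (f x) < e" unfolding dist_real_def by simp
  qed simp
qed

text \<open>By the Baire category theorem some interval inside (a, b) has all approximants from
  index \<open>N\<close> on agreeing up to e/4. There \<open>f\<close> is within e/4 of the
  continuous function \<open>s N\<close>, so its oscillation is small.\<close>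

lemma baire1_osc_dense:
  assumes "baire1 f" "e > 0"
  shows "{0..1} \<subseteq> closure {x \<in> {0..1}. osc f x < ereal e}"
proof (subst subset_closure_unit_iff, blast, intro allI impI)
  fix a b :: real
  assume ab: "0 \<le> a" "a < b" "b \<le> 1"
  from assms(1) obtain s where cont: "\<And>n::nat. continuous_on {0..1} (s n)"
    and lim: "\<And>x. x \<in> {0..1} \<Longrightarrow> (\<lambda>n. s n x) \<longlonglongrightarrow> f x" unfolding baire1_def by blast
  have contab: "continuous_on {a..b} (s n)" for n
    using cont continuous_on_subset ab by (metis atLeastatMost_subset_iff)
  define A where "A N = {x \<in> {a..b}. \<forall>i\<ge>N. \<forall>j\<ge>N. \<bar>s i x - s j x\<bar> \<le> e / 4}" for N :: nat
  have "closed {x \<in> {a..b}. \<bar>s i x - s j x\<bar> \<le> e / 4}" for i j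
    by (intro continuous_on_closed_Collect_le continuous_intros contab closed_atLeastAtMost)
  moreover have "A N = {a..b} \<inter> (\<Inter>i\<in>{N..}. \<Inter>j\<in>{N..}. {x \<in> {a..b}. \<bar>s i x - s j x\<bar> \<le> e / 4})" for N
    unfolding A_def by auto
  ultimately have closedA: "closed (A N)" for N
    by (simp add: closed_Int closed_INT)
  \<comment> \<open>The closed sets \<open>A N\<close> cover [a,b] because the approximants
    converge. If all complements were dense, their empty intersection would be dense.\<close>
  have "\<exists>N. \<not> {a..b} \<subseteq> closure ({a..b} - A N)"
  proof (rule ccontr)
    assume "\<nexists>N. \<not> {a..b} \<subseteq> closure ({a..b} - A N)"
    moreover have "openin (top_of_set {a..b}) ({a..b} - A N)" for N
      unfolding Diff_eq by (intro openin_open_Int open_Compl closedA)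
    ultimately have "{a..b} \<subseteq> closure (\<Inter> (range (\<lambda>N. {a..b} - A N)))"
      by (intro Baire) auto
    moreover have "\<Inter> (range (\<lambda>N. {a..b} - A N)) = {}"
    proof -
      have "\<exists>N. x \<in> A N" if x: "x \<in> {a..b}" for x
      proof -
        have "Cauchy (\<lambda>n. s n x)" using lim[of x] x ab by (intro LIMSEQ_imp_Cauchy) auto
        then obtain N where "\<forall>i\<ge>N. \<forall>j\<ge>N. dist (s i x) (s j x) < e / 4"
          using \<open>e > 0\<close> by (metis Cauchy_def divide_pos_pos zero_less_numeral)
        thus ?thesis using x unfolding A_def dist_real_def by (auto intro!: exI[of _ N] less_imp_le)
      qed
      thus ?thesis by auto
    qed
    ultimately have "{a..b} = {}" by (simp only: closure_empty subset_empty)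
    thus False using ab by simp
  qed
  then obtain N z where z: "z \<in> {a..b}" "z \<notin> closure ({a..b} - A N)" by blast
  then obtain r where r: "r > 0" "\<And>w. w \<in> {a..b} \<Longrightarrow> \<bar>w - z\<bar> < r \<Longrightarrow> w \<in> A N"
    unfolding closure_approachable dist_real_def by (metis DiffI)
  \<comment> \<open>The ball about \<open>z\<close> is cut down to an open interval inside [a,b],
    since \<open>z\<close> may be an end point.\<close>
  define lo where "lo = max a (z - r)"
  define hi where "hi = min b (z + r)"
  have "lo < hi" using ab z r(1) unfolding lo_def hi_def by auto
  define y where "y = (lo + hi) / 2"
  have y: "lo < y" "y < hi" using \<open>lo < hi\<close> unfolding y_def by auto
  have inA: "w \<in> A N" if "lo < w" "w < hi" for w
    using that unfolding lo_def hi_def by (intro r) auto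
  have y01: "y \<in> {0..1}" "a < y" "y < b" using y ab unfolding lo_def hi_def by auto
  have "continuous (at y within {0..1}) (s N)"
    using cont y01 by (simp add: continuous_on_eq_continuous_within)
  then obtain h where h: "h > 0" "\<And>w. w \<in> {0..1} \<Longrightarrow> \<bar>w - y\<bar> < h \<Longrightarrow> \<bar>s N w - s N y\<bar> < e / 16"
    using \<open>e > 0\<close> unfolding continuous_within_eps_delta dist_real_def
    by (metis divide_pos_pos zero_less_numeral)
  obtain k where k: "1 / 2 ^ k < min h (min (y - lo) (hi - y))"
    using ex_inverse_power_less[of "min h (min (y - lo) (hi - y))"] h(1) y by auto
  let ?B = "ball y (1 / 2 ^ k) \<inter> {0..1}"
  have close: "\<bar>f w - s N y\<bar> \<le> e / 4 + e / 16" if w: "w \<in> ?B" for w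
  proof -
    have w': "w \<in> {0..1}" "\<bar>w - y\<bar> < h" "lo < w" "w < hi"
      using w k by (auto simp: dist_real_def)
    from lim[OF w'(1)] have "(\<lambda>n. \<bar>s n w - s N w\<bar>) \<longlonglongrightarrow> \<bar>f w - s N w\<bar>" by (intro tendsto_intros)
    moreover have "\<forall>n\<ge>N. \<bar>s n w - s N w\<bar> \<le> e / 4"
      using inA[OF w'(3,4)] unfolding A_def by auto
    ultimately have "\<bar>f w - s N w\<bar> \<le> e / 4" using LIMSEQ_le_const2 by blast
    with h(2)[OF w'(1,2)] show ?thesis by linarith
  qed
  \<comment> \<open>Two errors of at most e/4 + e/16 add up to 5e/8, which is less than e.\<close>
  have "osc_on f ?B \<le> ereal (5 * e / 8)"
  proof (rule osc_on_le)
    show "?B \<noteq> {}" using y01(1) centre_in_ball[of y "1 / 2 ^ k"] by force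
  next
    fix u w assume "u \<in> ?B" "w \<in> ?B"
    from close[OF this(1)] close[OF this(2)] show "f u \<le> f w + 5 * e / 8" by linarith
  qed
  also have "\<dots> < ereal e" using \<open>e > 0\<close> by simp
  finally have "osc f y < ereal e" unfolding osc_less_iff by blast
  thus "\<exists>x\<in>{x \<in> {0..1}. osc f x < ereal e}. a < x \<and> x < b" using y01 by blast
qed

text \<open>The approximants are the Lipschitz envelopes from above: \<open>s n\<close> is Lipschitz
  with constant \<open>n\<close>, lies above \<open>g\<close>, and converges to \<open>g\<close> by
  upper semicontinuity.\<close>

lemma usc_imp_baire1:
  assumes usc: "\<And>x e. x \<in> {0..1} \<Longrightarrow> e > 0 \<Longrightarrow> \<exists>r>0. \<forall>y\<in>{0..1}. \<bar>y - x\<bar> < r \<longrightarrow> g y < g x + e"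
    and bounds: "\<And>x. x \<in> {0..1} \<Longrightarrow> 0 \<le> g x \<and> g x \<le> (1::real)"
  shows "baire1 g"
proof -
  define s where "s n x = (SUP y\<in>{0..1}. g y - real n * \<bar>x - y\<bar>)" for n and x :: real
  have bdd: "bdd_above ((\<lambda>y. g y - real n * \<bar>x - y\<bar>) ` {0..1})" for n x
  proof (rule bdd_aboveI)
    fix z assume "z \<in> (\<lambda>y. g y - real n * \<bar>x - y\<bar>) ` {0..1}"
    then obtain y where "y \<in> {0..1}" "z = g y - real n * \<bar>x - y\<bar>" by blast
    moreover have "real n * \<bar>x - y\<bar> \<ge> 0" by simp
    ultimately show "z \<le> 1" using bounds[of y] by linarith
  qed
  have upper: "g y - real n * \<bar>x - y\<bar> \<le> s n x" if "y \<in> {0..1}" for n x y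
    unfolding s_def using that by (intro cSUP_upper bdd)
  have least: "s n x \<le> c" if "\<And>y. y \<in> {0..1} \<Longrightarrow> g y - real n * \<bar>x - y\<bar> \<le> c" for n x c
    unfolding s_def using that by (intro cSUP_least) auto
  have lip: "s n x \<le> s n x' + real n * \<bar>x - x'\<bar>" for n x x'
  proof (rule least)
    fix y :: real assume y: "y \<in> {0..1}"
    have "real n * \<bar>x' - y\<bar> \<le> real n * \<bar>x - y\<bar> + real n * \<bar>x - x'\<bar>"
      unfolding distrib_left[symmetric] by (intro mult_left_mono) auto
    with upper[OF y, of n x'] show "g y - real n * \<bar>x - y\<bar> \<le> s n x' + real n * \<bar>x - x'\<bar>" by linarith
  qed
  have "continuous_on {0..1} (s n)" for n
  proof (rule lipschitz_on_continuous_on[of "real n"], rule lipschitz_onI)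
    fix x y :: real
    from lip[of n x y] lip[of n y x] show "dist (s n x) (s n y) \<le> real n * dist x y"
      unfolding dist_real_def by (simp add: abs_minus_commute abs_le_iff)
  qed simp
  moreover have "(\<lambda>n. s n x) \<longlonglongrightarrow> g x" if x: "x \<in> {0..1}" for x
  proof (rule LIMSEQ_I)
    fix e :: real assume "e > 0"
    with usc[OF x, of "e / 2"] obtain r where r: "r > 0"
      "\<And>y. y \<in> {0..1} \<Longrightarrow> \<bar>y - x\<bar> < r \<Longrightarrow> g y < g x + e / 2" by auto
    \<comment> \<open>Since \<open>g\<close> is at most 1, a point at distance \<open>r\<close> or
      more then contributes a negative value to the supremum, hence less than
      \<open>g x\<close>.\<close>
    obtain M where M: "1 < real M * r" using reals_Archimedean3[OF r(1)] by blast
    have "norm (s n x - g x) < e" if "n \<ge> M" for n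
    proof -
      have "s n x \<le> g x + e / 2"
      proof (rule least)
        fix y :: real assume y: "y \<in> {0..1}"
        show "g y - real n * \<bar>x - y\<bar> \<le> g x + e / 2"
        proof (cases "\<bar>y - x\<bar> < r")
          case True
          moreover have "real n * \<bar>x - y\<bar> \<ge> 0" by simp
          ultimately show ?thesis using r(2)[OF y] by linarith
        next
          case False
          have "real M * r \<le> real n * \<bar>x - y\<bar>"
            using that False r(1) by (intro mult_mono) auto
          moreover have "g y \<le> 1" "0 \<le> g x" using bounds x y by auto
          ultimately show ?thesis using M \<open>e > 0\<close> by linarith
        qed
      qed
      moreover have "g x \<le> s n x" using upper[OF x, of n x] by simp
      ultimately show ?thesis using \<open>e > 0\<close> by simp
    qed
    thus "\<exists>M. \<forall>n\<ge>M. norm (s n x - g x) < e" by blast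
  qed
  ultimately show ?thesis unfolding baire1_def by blast
qed

text \<open>Near \<open>x\<close> the supremum is at most \<open>g x + e\<close> by upper
  semicontinuity, while the dense zeros make every infimum 0.\<close>

lemma osc_usc_eq:
  assumes usc: "\<And>e. e > 0 \<Longrightarrow> \<exists>r>0. \<forall>y\<in>{0..1}. \<bar>y - x\<bar> < r \<longrightarrow> g y < g x + e"
    and nonneg: "\<And>y. y \<in> {0..1} \<Longrightarrow> 0 \<le> g y"
    and dense: "{0..1} \<subseteq> closure D" and zero: "\<And>y. y \<in> D \<Longrightarrow> g y = 0" and D: "D \<subseteq> {0..1}"
    and x: "x \<in> {0..1}"
  shows "osc g x = ereal (g x)"
proof (rule antisym)
  show "osc g x \<le> ereal (g x)"
  proof (rule ereal_le_epsilon2)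
    fix e :: real assume "e > 0"
    with usc obtain r where r: "r > 0" "\<And>y. y \<in> {0..1} \<Longrightarrow> \<bar>y - x\<bar> < r \<Longrightarrow> g y < g x + e"
      by blast
    obtain k where k: "1 / 2 ^ k < r" using ex_inverse_power_less[OF r(1)] by blast
    let ?B = "ball x (1 / 2 ^ k) \<inter> {0..1}"
    have "osc g x \<le> osc_on g ?B" unfolding osc_eq_INF by (rule INF_lower) simp
    also have "\<dots> \<le> ereal (g x + e)"
    proof (rule osc_on_le)
      show "?B \<noteq> {}" using x centre_in_ball[of x "1 / 2 ^ k"] by force
    next
      fix u w assume "u \<in> ?B" "w \<in> ?B"
      hence "g u < g x + e" "0 \<le> g w" using k by (auto intro!: r nonneg simp: dist_real_def)
      thus "g u \<le> g w + (g x + e)" by linarith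
    qed
    finally show "osc g x \<le> ereal (g x) + ereal e" by simp
  qed
next
  show "ereal (g x) \<le> osc g x"
    unfolding osc_eq_INF
  proof (rule INF_greatest)
    fix k :: nat
    have "x \<in> closure D" using dense x by blast
    then obtain z where z: "z \<in> D" "dist z x < 1 / 2 ^ k"
      unfolding closure_approachable by (metis zero_less_divide_1_iff zero_less_numeral zero_less_power)
    let ?B = "ball x (1 / 2 ^ k) \<inter> {0..1}"
    have "z \<in> ?B" "x \<in> ?B" using z x D by (auto simp: dist_commute)
    from osc_on_ge[OF this(2,1), of g] show "ereal (g x) \<le> osc_on g ?B" using zero[OF z(1)] by simp
  qed
qed

subsection \<open>The two reductions\<close>

lemma tuple_case_nat: "tuple Fs (case_nat i q) = (if i < length Fs then (Fs ! i) q else 0)"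
  by (simp add: tuple_def join_def)

lemma tuple_const: "tuple ((\<lambda>_. n) # Fs) (\<lambda>_. 0) = n"
  by (simp add: tuple_def join_def)

text \<open>The characteristic function of the m-th set in the first reduction. The centre in
  \<open>near\<close> is 0/2^0; as the oscillation is nonnegative, its distance from 0 is its
  value.\<close>

definition cont_set_query :: "tp2 \<Rightarrow> tp2 \<Rightarrow> tp2 \<Rightarrow> nat \<Rightarrow> tp2" where
  "cont_set_query FD FY Fg m q = of_bool ((FD q = 1 \<longrightarrow> m < FY q) \<and> near (\<lambda>n. Fg (case_nat n q)) 0 0 m)"

lemma cont_query_tuple:
  "cont_query (tuple [\<lambda>_. n, FD, FY, Ff, Fg]) = tuple [\<lambda>_. n, join (cont_set_query FD FY Fg)]"
  unfolding cont_query_def tuple_case_nat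
  by (auto simp: fun_eq_iff tuple_const cont_set_query_def tuple_def join_def nth_Cons' less_Suc_eq numeral_eq_Suc)

lemma query_tuple: "query (tuple [\<lambda>_. n, join Fs]) = Fs"
  by (intro ext) (simp add: query_def tuple_case_nat, simp add: join_def)

lemma baire_query_tuple:
  fixes Fs :: "nat \<Rightarrow> tp2"
  defines "Ff \<equiv> (\<lambda>h. bad_code Fs (\<lambda>n. h (Suc n)))"
  shows "baire_query (tuple [\<lambda>_. n, join Fs]) =
    tuple [\<lambda>_. n, \<lambda>q. of_bool (\<exists>i. is_pick Fs q i), pick_index Fs, Ff, Ff]"
  unfolding baire_query_def query_tuple Ff_def
  by (auto simp: fun_eq_iff tuple_const tuple_def join_def nth_Cons' less_Suc_eq numeral_eq_Suc)

text \<open>The query leaves the number argument alone, so the oracle's output is returned value by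
  value.\<close>

lemma outputs_computed:
  assumes "\<And>(\<Gamma> :: ptp3) F m. \<Gamma> (H F) = Some m \<Longrightarrow> computed e \<Gamma> F = Some m"
    and "\<And>n. H (tuple ((\<lambda>_. n) # Fs)) = tuple ((\<lambda>_. n) # Gs)"
    and "outputs \<Gamma> Gs p"
  shows "outputs (computed e \<Gamma>) Fs p"
  using assms unfolding outputs_def by simp

text \<open>Injectivity of \<open>Y\<close> makes the set of removed points finite, and removing
  finitely many points from an open dense subset of [0,1] keeps it open and dense.\<close>

lemma continuity_sets_dense:
  assumes "D \<subseteq> {0..1}" "inj_on Y D" "baire1 f"
  shows "openin (top_of_set {0..1}) {x \<in> {0..1}. (x \<in> D \<longrightarrow> m < Y x) \<and> osc f x < ereal (1 / 2 ^ m)}"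
    (is "openin _ ?O")
    and "{0..1} \<subseteq> closure {x \<in> {0..1}. (x \<in> D \<longrightarrow> m < Y x) \<and> osc f x < ereal (1 / 2 ^ m)}"
proof -
  define S where "S = {x \<in> D. Y x \<le> m}"
  define U where "U = {x \<in> {0..1}. osc f x < ereal (1 / 2 ^ m)}"
  have O_eq: "?O = U - S" unfolding U_def S_def by auto
  have U: "openin (top_of_set {0..1}) U" unfolding U_def by (rule openin_osc_less)
  have "Y ` S \<subseteq> {..m}" "inj_on Y S" using assms(2) unfolding S_def by (auto simp: inj_on_def)
  hence S: "finite S" using finite_imageD finite_subset by blast
  have "openin (top_of_set {0..1}) (U \<inter> ({0..1} \<inter> - S))"
    by (intro openin_Int U openin_open_Int open_Compl finite_imp_closed S)
  moreover have "U \<inter> ({0..1} \<inter> - S) = U - S" unfolding U_def by auto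
  ultimately show "openin (top_of_set {0..1}) ?O" unfolding O_eq by simp
  have "{0..1} \<subseteq> closure (U - S)"
  proof (subst subset_closure_unit_iff)
    show "U - S \<subseteq> {0..1}" unfolding U_def by auto
    show "\<forall>a b. 0 \<le> a \<longrightarrow> a < b \<longrightarrow> b \<le> 1 \<longrightarrow> (\<exists>x\<in>U - S. a < x \<and> x < b)"
    proof (intro allI impI)
      fix a b :: real assume ab: "0 \<le> a" "a < b" "b \<le> 1"
      have "{0..1} \<subseteq> closure U" unfolding U_def using assms(3) by (intro baire1_osc_dense) auto
      moreover have "U \<subseteq> {0..1}" unfolding U_def by auto
      ultimately obtain x where x: "x \<in> U" "a < x" "x < b"
        using ab by (metis subset_closure_unit_iff)
      from U x(1) obtain r where r: "r > 0" "\<And>y. y \<in> {0..1} \<Longrightarrow> \<bar>y - x\<bar> < r \<Longrightarrow> y \<in> U"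
        unfolding openin_unit_iff by blast
      have "infinite {x<..<min b (x + r)}" using x r(1) by (intro infinite_Ioo) auto
      with S obtain y where y: "y \<in> {x<..<min b (x + r)}" "y \<notin> S" by (meson finite_subset subsetI)
      have "y \<in> U" using y x ab by (intro r(2)) auto
      thus "\<exists>x\<in>U - S. a < x \<and> x < b" using y x by (intro bexI[of _ y]) auto
    qed
  qed
  thus "{0..1} \<subseteq> closure ?O" unfolding O_eq .
qed

text \<open>The answer is always of the second kind: a point of continuity outside
  \<open>D\<close>.\<close>

lemma baire_realiser_imp_spec_k:
  "\<exists>e. \<forall>\<Gamma>. baire_realiser \<Gamma> \<longrightarrow> spec_k (\<lambda>Y D. inj_on Y D) (computed e \<Gamma>)"
proof -
  from computed_eq[OF computable_cont_query] obtain e where e: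
    "\<And>(\<Gamma> :: ptp3) F m. \<Gamma> (cont_query F) = Some m \<Longrightarrow> computed e \<Gamma> F = Some m" by blast
  show ?thesis
  proof (intro exI[of _ e] allI impI)
    fix \<Gamma> assume \<Gamma>: "baire_realiser \<Gamma>"
    show "spec_k (\<lambda>Y D. inj_on Y D) (computed e \<Gamma>)"
      unfolding spec_k_def
    proof (intro allI impI, elim conjE)
      fix D Y f g FD FY Ff Fg
      assume D: "D \<subseteq> {0..1}" and inj: "inj_on Y D" and f: "baire1 f"
        and g: "\<forall>x\<in>{0..1}. osc f x = ereal (g x)"
        and codes: "codes_set FD D" "codes_nat_fun FY Y" "codes_real_fun Fg g"
      define Q where "Q m = {x \<in> {0..1}. (x \<in> D \<longrightarrow> m < Y x) \<and> osc f x < ereal (1 / 2 ^ m)}" for m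
      have "codes_set (cont_set_query FD FY Fg m) (Q m)" for m
        unfolding codes_set_def codes_nat_fun_def
      proof (intro ballI allI impI)
        fix x p assume x: "x \<in> {0..1::real}" and p: "codes_real p x"
        have "codes_real (\<lambda>n. Fg (case_nat n p)) (g x)"
          using codes(3) x p unfolding codes_real_fun_def by blast
        hence "near (\<lambda>n. Fg (case_nat n p)) 0 0 m \<longleftrightarrow> \<bar>g x\<bar> < 1 / 2 ^ m"
          by (simp add: near_iff)
        also have "0 \<le> g x" using osc_nonneg[OF x, of f] g x by simp
        hence "\<bar>g x\<bar> < 1 / 2 ^ m \<longleftrightarrow> osc f x < ereal (1 / 2 ^ m)" using g x by simp
        finally have "near (\<lambda>n. Fg (case_nat n p)) 0 0 m \<longleftrightarrow> osc f x < ereal (1 / 2 ^ m)" .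
        moreover have "FD p = (if x \<in> D then 1 else 0)" "FY p = Y x"
          using codes(1,2) x p unfolding codes_set_def codes_nat_fun_def by blast+
        ultimately show "cont_set_query FD FY Fg m p = (if x \<in> Q m then 1 else 0)"
          using x unfolding cont_set_query_def Q_def by simp
      qed
      moreover have "Q m \<subseteq> {0..1}" for m unfolding Q_def by auto
      moreover have "openin (top_of_set {0..1}) (Q m)" "{0..1} \<subseteq> closure (Q m)" for m
        unfolding Q_def by (rule continuity_sets_dense[OF D inj f])+
      ultimately obtain p x where out: "outputs \<Gamma> [join (cont_set_query FD FY Fg)] p"
        and x: "codes_real p x" "x \<in> (\<Inter>m. Q m)"
        using \<Gamma>[unfolded baire_realiser_def, rule_format, of Q "cont_set_query FD FY Fg"] by blast
      have Q: "x \<in> Q m" for m using x(2) by blast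
      have x01: "x \<in> {0..1}" using Q[of 0] unfolding Q_def by blast
      \<comment> \<open>A point of \<open>D\<close> is removed from the set with index
        \<open>Y x\<close>, because \<open>m < Y x\<close> fails at \<open>m = Y x\<close>.\<close>
      have "x \<notin> D" using Q[of "Y x"] unfolding Q_def by blast
      moreover have "osc f x \<le> 0"
      proof -
        have "g x < 1 / 2 ^ m" for m using Q[of m] g unfolding Q_def by auto
        hence "g x \<le> 0" using ex_inverse_power_less[of "g x"] by (metis less_asym not_less)
        thus ?thesis using g x01 by simp
      qed
      hence "continuous (at x within {0..1}) f" by (rule continuous_if_osc_le_0[OF x01])
      moreover have "outputs (computed e \<Gamma>) [FD, FY, Ff, Fg] p"
        using e cont_query_tuple out by (rule outputs_computed)
      ultimately show "\<exists>p x. outputs (computed e \<Gamma>) [FD, FY, Ff, Fg] p \<and> codes_real p x \<and>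
          (x \<in> D \<and> \<not> continuous (at x within {0..1}) f \<or>
           x \<in> {0..1} - D \<and> continuous (at x within {0..1}) f)"
        using x(1) x01 by blast
    qed
  qed
qed

section \<open>A dense sequence of distinct dyadic points in the finite intersections\<close>

text \<open>For fixed \<open>i\<close> the exponents \<open>prod_encode (i, b)\<close> are
  unbounded, being at least \<open>b\<close>. Odd multiples of 2^-l are 2 * 2^-l apart, so one of
  them is within 2^-l of \<open>x\<close>.\<close>

lemma odd_dyadic_approx:
  fixes x r :: real
  assumes "x \<ge> 0" "r > 0"
  shows "\<exists>a b. \<bar>real (2 * a + 1) / 2 ^ prod_encode (i, b) - x\<bar> < r"
proof -
  obtain b where b: "1 / 2 ^ b < r" using ex_inverse_power_less[OF assms(2)] by blast
  define l where "l = prod_encode (i, b)"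
  have "(2::real) ^ b \<le> 2 ^ l" unfolding l_def by (intro power_increasing le_prod_encode_2) auto
  hence "1 / 2 ^ l \<le> (1::real) / 2 ^ b" by (intro divide_left_mono) auto
  with b have l: "1 / 2 ^ l < r" by linarith
  define a where "a = nat \<lfloor>x * 2 ^ l / 2\<rfloor>"
  have "real a = of_int \<lfloor>x * 2 ^ l / 2\<rfloor>" unfolding a_def using assms(1) by simp
  hence "2 * real a \<le> x * 2 ^ l" "x * 2 ^ l < 2 * real a + 2" by linarith+
  hence "\<bar>real (2 * a + 1) - x * 2 ^ l\<bar> \<le> 1" by simp
  moreover have "real (2 * a + 1) / 2 ^ l - x = (real (2 * a + 1) - x * 2 ^ l) / 2 ^ l"
    by (simp add: field_simps)
  ultimately have "\<bar>real (2 * a + 1) / 2 ^ l - x\<bar> \<le> 1 / 2 ^ l"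
    by (simp add: divide_right_mono)
  with l show ?thesis unfolding l_def by (meson le_less_trans)
qed

text \<open>With different exponents, cross-multiplication would make an odd number even.\<close>

lemma odd_dyadic_inj:
  assumes "real (2 * a + 1) / 2 ^ l = real (2 * b + 1) / 2 ^ m"
  shows "l = m"
proof -
  have aux: "m \<le> l" if "real (2 * a + 1) / 2 ^ l = real (2 * b + 1) / 2 ^ m" for a b l m :: nat
  proof (rule ccontr)
    assume "\<not> m \<le> l"
    then obtain k where k: "m = l + Suc k" by (metis less_iff_Suc_add not_le add_Suc_right)
    from that have "real (2 * a + 1) * 2 ^ m = real (2 * b + 1) * 2 ^ l" 
      by (rule frac_eq_eq[THEN iffD1, rotated 2]) simp_all
    hence "real ((2 * a + 1) * 2 ^ m) = real ((2 * b + 1) * 2 ^ l)" by (simp add: algebra_simps)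
    hence "(2 * a + 1) * 2 ^ m = (2 * b + 1) * 2 ^ l" by (simp only: of_nat_eq_iff)
    hence "((2 * a + 1) * 2 ^ Suc k) * 2 ^ l = (2 * b + 1) * 2 ^ l"
      unfolding k power_add by (simp only: ac_simps)
    hence "(2 * a + 1) * 2 ^ Suc k = 2 * b + 1" by (simp only: mult_cancel_right) simp
    hence "even (2 * b + 1)" by (metis dvd_mult dvd_power zero_less_Suc)
    thus False by simp
  qed
  from aux[OF assms] aux[OF assms[symmetric]] show ?thesis by simp
qed

locale dense_open_seq =
  fixes Os :: "nat \<Rightarrow> real set" and Fs :: "nat \<Rightarrow> tp2"
  assumes dense: "\<And>n. {0..1} \<subseteq> closure (Os n)"
    and opn: "\<And>n. openin (top_of_set {0..1}) (Os n)"
    and codes: "\<And>n. codes_set (Fs n) (Os n)"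
begin

definition dyadic :: "nat \<Rightarrow> nat \<Rightarrow> real" where
  "dyadic i t = odd_num t / 2 ^ exponent i t"

lemma Fs_eq: "codes_real p x \<Longrightarrow> x \<in> {0..1} \<Longrightarrow> Fs n p = 1 \<longleftrightarrow> x \<in> Os n"
  using codes[of n] unfolding codes_set_def codes_nat_fun_def by auto

lemma good_iff: "good Fs i t \<longleftrightarrow> dyadic i t \<in> {0..1} \<and> (\<forall>j\<le>i. dyadic i t \<in> Os j) \<and>
    (fst (prod_decode i) \<le> 2 ^ snd (prod_decode i) \<longrightarrow>
      \<bar>dyadic i t - fst (prod_decode i) / 2 ^ snd (prod_decode i)\<bar> < 1 / 2 ^ snd (prod_decode i))"
proof -
  have code: "codes_real (\<lambda>_. rat_code (odd_num t) (exponent i t)) (dyadic i t)"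
    unfolding dyadic_def by (rule codes_real_const) simp
  have "odd_num t \<le> 2 ^ exponent i t \<longleftrightarrow> real (odd_num t) \<le> real (2 ^ exponent i t)" by (simp only: of_nat_le_iff)
  also have "\<dots> \<longleftrightarrow> dyadic i t \<in> {0..1}" unfolding dyadic_def by simp
  finally have le: "odd_num t \<le> 2 ^ exponent i t \<longleftrightarrow> dyadic i t \<in> {0..1}" .
  show ?thesis
    unfolding good_def le near_iff[OF code] using Fs_eq[OF code] by auto
qed

text \<open>A finite intersection of dense open sets is dense and open, so it meets the basic
  interval, and a nearby dyadic point with an admissible exponent still lies in both.\<close>

lemma ex_good: "\<exists>t. good Fs i t"
proof -
  define c where "c = fst (prod_decode i)"
  define k where "k = snd (prod_decode i)"
  define U where "U = \<Inter> (Os ` {..i})"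
  have opU: "openin (top_of_set {0..1}) U"
    unfolding U_def by (intro openin_Inter) (auto simp: opn)
  have denseU: "{0..1} \<subseteq> closure U"
    unfolding U_def by (intro Baire) (auto simp: opn intro: subsetD[OF dense])
  \<comment> \<open>The end points of the basic interval clipped to [0,1], or all of [0,1] if
    \<open>i\<close> imposes no interval.\<close>
  define a b where "a = (if c \<le> 2 ^ k then max 0 (c / 2 ^ k - 1 / 2 ^ k) else 0 :: real)"
    and "b = (if c \<le> 2 ^ k then min 1 (c / 2 ^ k + 1 / 2 ^ k) else 1 :: real)"
  have c1: "real c / 2 ^ k \<le> 1" if "c \<le> 2 ^ k"
  proof -
    have "real c \<le> 2 ^ k" using that by (metis of_nat_le_iff of_nat_numeral of_nat_power)
    thus ?thesis by simp
  qed
  have "0 \<le> a" "b \<le> 1" unfolding a_def b_def by auto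
  moreover have "a < b"
  proof (cases "c \<le> 2 ^ k")
    case True
    have "(0::real) < 1 / 2 ^ k" "0 \<le> real c / 2 ^ k" by simp_all
    with c1[OF True] have "real c / 2 ^ k - 1 / 2 ^ k < 1" "0 < real c / 2 ^ k + 1 / 2 ^ k"
      by linarith+
    thus ?thesis using True unfolding a_def b_def by simp
  qed (simp add: a_def b_def)
  moreover have U01: "U \<subseteq> {0..1}" using opU openin_imp_subset by blast
  ultimately obtain x where x: "x \<in> U" "a < x" "x < b"
    using denseU subset_closure_unit_iff by metis
  from opU x(1) obtain r where r: "r > 0" "\<And>y. y \<in> {0..1} \<Longrightarrow> \<bar>y - x\<bar> < r \<Longrightarrow> y \<in> U"
    unfolding openin_unit_iff by blast
  have "min r (min (x - a) (b - x)) > 0" using r x by auto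
  with odd_dyadic_approx[of x _ i] x \<open>0 \<le> a\<close> obtain u w where
    uw: "\<bar>real (2 * u + 1) / 2 ^ prod_encode (i, w) - x\<bar> < min r (min (x - a) (b - x))"
    by (meson le_less_trans less_imp_le)
  define t where "t = prod_encode (u, w)"
  have dyadic: "\<bar>dyadic i t - x\<bar> < min r (min (x - a) (b - x))"
    using uw unfolding dyadic_def odd_num_def exponent_def t_def by simp
  hence ab: "a < dyadic i t" "dyadic i t < b" by auto
  hence "dyadic i t \<in> {0..1}" using \<open>0 \<le> a\<close> \<open>b \<le> 1\<close> by auto
  moreover from this dyadic have "dyadic i t \<in> U" by (intro r(2)) auto
  moreover have "\<bar>dyadic i t - c / 2 ^ k\<bar> < 1 / 2 ^ k" if "c \<le> 2 ^ k"
    using ab that unfolding a_def b_def by auto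
  ultimately have "good Fs i t" unfolding good_iff U_def c_def k_def by auto
  thus ?thesis ..
qed

definition point :: "nat \<Rightarrow> real" where
  "point i = dyadic i (pick Fs i)"

lemma good_pick: "good Fs i (pick Fs i)"
proof -
  have "(\<exists>s. good Fs i s) \<longrightarrow> good Fs i (pick Fs i)"
    unfolding pick_def by (rule LeastI_ex) auto
  with ex_good show ?thesis by blast
qed

lemma point_unit: "point i \<in> {0..1}"
  and point_in: "j \<le> i \<Longrightarrow> point i \<in> Os j"
  and point_near: "c \<le> 2 ^ k \<Longrightarrow> \<bar>point (prod_encode (c, k)) - c / 2 ^ k\<bar> < 1 / 2 ^ k"
  using good_pick[of i] good_pick[of "prod_encode (c, k)"] unfolding good_iff point_def by auto

lemma inj_point: "inj point"
proof (rule injI)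
  fix i j assume "point i = point j"
  hence "exponent i (pick Fs i) = exponent j (pick Fs j)"
    unfolding point_def dyadic_def odd_num_def by (rule odd_dyadic_inj)
  thus "i = j" unfolding exponent_def by simp
qed

lemma range_point_dense: "{0..1} \<subseteq> closure (range point)"
proof (subst subset_closure_unit_iff)
  show "range point \<subseteq> {0..1}" using point_unit by blast
  show "\<forall>a b. 0 \<le> a \<longrightarrow> a < b \<longrightarrow> b \<le> 1 \<longrightarrow> (\<exists>x\<in>range point. a < x \<and> x < b)"
  proof (intro allI impI)
    fix a b :: real assume ab: "0 \<le> a" "a < b" "b \<le> 1"
    \<comment> \<open>A quarter of the length: the chosen point is within 2^-k of c/2^k, which is
      within 2^-k of the midpoint \<open>m\<close>.\<close>
    obtain k where k: "1 / 2 ^ k < (b - a) / 4" using ex_inverse_power_less[of "(b - a) / 4"] ab by auto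
    define m where "m = (a + b) / 2"
    define c where "c = nat \<lfloor>m * 2 ^ k\<rfloor>"
    have m: "0 \<le> m" "m \<le> 1" using ab unfolding m_def by auto
    have c: "real c = of_int \<lfloor>m * 2 ^ k\<rfloor>" unfolding c_def using m by simp
    hence c': "real c \<le> m * 2 ^ k" "m * 2 ^ k < real c + 1" by linarith+
    have "m * 2 ^ k \<le> 1 * 2 ^ k" using m by (intro mult_right_mono) auto
    with c' have "real c \<le> 2 ^ k" by linarith
    hence "c \<le> 2 ^ k" by (metis of_nat_le_iff of_nat_numeral of_nat_power)
    from point_near[OF this] have near: "\<bar>point (prod_encode (c, k)) - c / 2 ^ k\<bar> < 1 / 2 ^ k" .
    have "m - c / 2 ^ k = (m * 2 ^ k - c) / 2 ^ k" by (simp add: field_simps)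
    moreover have "\<bar>m * 2 ^ k - c\<bar> \<le> 1" using c' by simp
    ultimately have "\<bar>m - c / 2 ^ k\<bar> \<le> 1 / 2 ^ k" by (simp add: divide_right_mono)
    with near k have "\<bar>point (prod_encode (c, k)) - m\<bar> < (b - a) / 2" by linarith
    hence "a < point (prod_encode (c, k))" "point (prod_encode (c, k)) < b"
      unfolding m_def by (simp_all add: abs_less_iff field_simps)
    thus "\<exists>x\<in>range point. a < x \<and> x < b" by blast
  qed
qed

section \<open>The upper semicontinuous function that vanishes on the dense sequence\<close>

definition excluded :: "real \<Rightarrow> nat \<Rightarrow> bool" where
  "excluded x k \<longleftrightarrow> x \<notin> Os (fst (prod_decode k)) \<and>
    (\<forall>i<fst (prod_decode k). \<not> \<bar>x - point i\<bar> < 1 / 2 ^ snd (prod_decode k))"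

definition height :: "real \<Rightarrow> real" where
  "height x = (if \<exists>k. excluded x k then 1 / 2 ^ (LEAST k. excluded x k) else 0)"

lemma near_pick_iff: "codes_real q x \<Longrightarrow> near_pick Fs q i j \<longleftrightarrow> \<bar>x - point i\<bar> < 1 / 2 ^ j"
  unfolding near_pick_def point_def dyadic_def by (rule near_iff)

lemma is_pick_iff:
  assumes "codes_real q x"
  shows "is_pick Fs q i \<longleftrightarrow> x = point i"
proof -
  have "x = point i" if "\<forall>j. \<bar>x - point i\<bar> < 1 / 2 ^ j"
    using that ex_inverse_power_less[of "\<bar>x - point i\<bar>"] by (meson less_asym zero_less_abs_iff right_minus_eq)
  thus ?thesis unfolding is_pick_def near_pick_iff[OF assms] by auto
qed

lemma bad_iff:
  assumes "codes_real q x" "x \<in> {0..1}"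
  shows "bad Fs q k \<longleftrightarrow> excluded x k"
  unfolding bad_def excluded_def near_pick_iff[OF assms(1)] Fs_eq[OF assms] ..

lemma real_code_bad_code:
  assumes "codes_real q x" "x \<in> {0..1}"
  shows "real_code (bad_code Fs q) = height x"
proof (cases "\<exists>k. excluded x k")
  case True
  hence "(LEAST k. (\<exists>l. excluded x l) \<longrightarrow> excluded x k) = (LEAST k. excluded x k)" by simp
  with True show ?thesis unfolding bad_code_def bad_iff[OF assms] height_def by simp
next
  case False
  have "real_code 0 = 0" by (simp add: nat_to_rat_surj_def prod_decode_def prod_decode_aux.simps int_decode_def sum_decode_def rat_number_collapse)
  with False show ?thesis unfolding bad_code_def bad_iff[OF assms] height_def by simp
qed

text \<open>With m the first component of \<open>k\<close>: for i < m the point has distance 0 from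
  itself, and for i >= m it lies in \<open>Os m\<close>.\<close>

lemma not_excluded_point: "\<not> excluded (point i) k"
  unfolding excluded_def using point_in[of "fst (prod_decode k)" i] by (cases "i < fst (prod_decode k)") auto

lemma height_point: "height (point i) = 0"
  unfolding height_def using not_excluded_point by simp

lemma height_bounds: "0 \<le> height x" "height x \<le> 1"
  unfolding height_def by auto

lemma height_le:
  assumes "\<forall>k<n. \<not> excluded x k"
  shows "height x \<le> 1 / 2 ^ n"
proof (cases "\<exists>k. excluded x k")
  case True
  hence "excluded x (LEAST k. excluded x k)" by (rule LeastI_ex)
  with assms have "n \<le> (LEAST k. excluded x k)" by (meson not_le)
  thus ?thesis using True unfolding height_def by (simp add: divide_left_mono power_increasing)
qed (simp add: height_def)

lemma not_excluded_nbhd: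
  assumes "x \<in> {0..1}" "\<not> excluded x k"
  shows "\<exists>r>0. \<forall>y\<in>{0..1}. \<bar>y - x\<bar> < r \<longrightarrow> \<not> excluded y k"
proof (cases "x \<in> Os (fst (prod_decode k))")
  case True
  with opn obtain r where "r > 0" "\<And>y. y \<in> {0..1} \<Longrightarrow> \<bar>y - x\<bar> < r \<Longrightarrow> y \<in> Os (fst (prod_decode k))"
    unfolding openin_unit_iff by metis
  thus ?thesis unfolding excluded_def by blast
next
  case False
  with assms obtain i where i: "i < fst (prod_decode k)" "\<bar>x - point i\<bar> < 1 / 2 ^ snd (prod_decode k)"
    unfolding excluded_def by blast
  have "\<not> excluded y k" if "\<bar>y - x\<bar> < 1 / 2 ^ snd (prod_decode k) - \<bar>x - point i\<bar>" for y
  proof -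
    have "\<bar>y - point i\<bar> < 1 / 2 ^ snd (prod_decode k)" using that by linarith
    thus ?thesis using i(1) unfolding excluded_def by blast
  qed
  thus ?thesis using i(2) by (intro exI[of _ "1 / 2 ^ snd (prod_decode k) - \<bar>x - point i\<bar>"]) auto
qed

lemma not_excluded_nbhd_less:
  assumes "x \<in> {0..1}" "\<forall>k<n. \<not> excluded x k"
  shows "\<exists>r>0. \<forall>y\<in>{0..1}. \<bar>y - x\<bar> < r \<longrightarrow> (\<forall>k<n. \<not> excluded y k)"
  using assms(2)
proof (induction n)
  case 0
  show ?case by (intro exI[of _ 1]) auto
next
  case (Suc n)
  then obtain r where r: "r > 0" "\<And>y k. y \<in> {0..1} \<Longrightarrow> \<bar>y - x\<bar> < r \<Longrightarrow> k < n \<Longrightarrow> \<not> excluded y k" by fastforce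
  obtain s where s: "s > 0" "\<And>y. y \<in> {0..1} \<Longrightarrow> \<bar>y - x\<bar> < s \<Longrightarrow> \<not> excluded y n"
    using not_excluded_nbhd[OF assms(1)] Suc.prems by blast
  show ?case
    using r s by (intro exI[of _ "min r s"]) (auto simp: less_Suc_eq)
qed

text \<open>If \<open>x\<close> misses the first \<open>n\<close> closed sets, so does a whole
  neighbourhood, and there the height is at most 2^-n.\<close>

lemma height_usc:
  assumes x: "x \<in> {0..1}" and e: "e > 0"
  shows "\<exists>r>0. \<forall>y\<in>{0..1}. \<bar>y - x\<bar> < r \<longrightarrow> height y < height x + e"
proof -
  have "\<exists>n. (\<forall>k<n. \<not> excluded x k) \<and> 1 / 2 ^ n < height x + e"
  proof (cases "\<exists>k. excluded x k")
    case True
    hence "1 / 2 ^ (LEAST k. excluded x k) < height x + e" using e unfolding height_def by simp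
    moreover have "\<forall>k<LEAST k. excluded x k. \<not> excluded x k" using not_less_Least by blast
    ultimately show ?thesis by blast
  next
    case False
    hence "height x = 0" unfolding height_def by simp
    with False ex_inverse_power_less[OF e] show ?thesis by simp
  qed
  then obtain n where n: "\<forall>k<n. \<not> excluded x k" "1 / 2 ^ n < height x + e" by blast
  from not_excluded_nbhd_less[OF x n(1)] height_le n(2) show ?thesis by (meson le_less_trans)
qed

lemma osc_height: "x \<in> {0..1} \<Longrightarrow> osc height x = ereal (height x)"
  by (rule osc_usc_eq[OF height_usc _ range_point_dense]) (use height_bounds height_point point_unit in auto)

lemma baire1_height: "baire1 height"
  using height_usc height_bounds by (intro usc_imp_baire1) auto

text \<open>The height vanishes on a dense set, so a positive value cannot be approached
  continuously.\<close>

lemma continuous_imp_height_eq_0: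
  assumes x: "x \<in> {0..1}" and cont: "continuous (at x within {0..1}) height"
  shows "height x = 0"
proof (rule ccontr)
  assume "height x \<noteq> 0"
  hence "height x > 0" using height_bounds(1)[of x] by linarith
  with cont obtain r where r: "r > 0" "\<And>y. y \<in> {0..1} \<Longrightarrow> dist y x < r \<Longrightarrow> dist (height y) (height x) < height x"
    unfolding continuous_within_eps_delta by meson
  have "x \<in> closure (range point)" using range_point_dense x by blast
  then obtain i where "dist (point i) x < r" using r(1) unfolding closure_approachable by blast
  from r(2)[OF point_unit this] show False unfolding height_point by (simp add: dist_real_def)
qed

lemma in_all_Os:
  assumes "x \<in> {0..1}" "x \<notin> range point" "height x = 0"
  shows "x \<in> Os m"
proof (rule ccontr)
  assume m: "x \<notin> Os m"
  \<comment> \<open>A point outside the sequence has a positive distance from finitely many of its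
    members; some 2^-j is below all these distances.\<close>
  have "\<exists>j. \<forall>i<n. \<not> \<bar>x - point i\<bar> < 1 / 2 ^ j" for n
  proof (induction n)
    case (Suc n)
    then obtain j where j: "\<forall>i<n. \<not> \<bar>x - point i\<bar> < 1 / 2 ^ j" by blast
    have "\<bar>x - point n\<bar> > 0" using assms(2) by auto
    then obtain l where l: "1 / 2 ^ l < \<bar>x - point n\<bar>" using ex_inverse_power_less by blast
    have le: "(1::real) / 2 ^ max j l \<le> 1 / 2 ^ j" "(1::real) / 2 ^ max j l \<le> 1 / 2 ^ l"
      by (intro divide_left_mono power_increasing; simp)+
    have "\<not> \<bar>x - point i\<bar> < 1 / 2 ^ max j l" if "i < Suc n" for i
    proof (cases "i = n")
      case True
      show ?thesis using le l unfolding True by linarith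
    next
      case False
      hence "\<not> \<bar>x - point i\<bar> < 1 / 2 ^ j" using that j by auto
      thus ?thesis using le by linarith
    qed
    thus ?case by blast
  qed auto
  then obtain j where "\<forall>i<m. \<not> \<bar>x - point i\<bar> < 1 / 2 ^ j" by blast
  with m have "excluded x (prod_encode (m, j))" unfolding excluded_def by simp
  hence "height x > 0" unfolding height_def by auto
  thus False using assms(3) by simp
qed

section \<open>The inputs for specification (k) and the answer\<close>

lemma codes_range_point: "codes_set (\<lambda>q. of_bool (\<exists>i. is_pick Fs q i)) (range point)"
  unfolding codes_set_def codes_nat_fun_def by (auto simp: is_pick_iff)

definition index :: "real \<Rightarrow> nat" where
  "index x = (LEAST i. (\<exists>j. x = point j) \<longrightarrow> x = point i)"

lemma codes_index: "codes_nat_fun (pick_index Fs) index"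
  unfolding codes_nat_fun_def
proof (intro ballI allI impI)
  fix x p assume "x \<in> {0..1}" "codes_real p x"
  hence "is_pick Fs p = (\<lambda>i. x = point i)" by (simp add: fun_eq_iff is_pick_iff)
  thus "pick_index Fs p = index x" unfolding pick_index_def index_def by simp
qed

text \<open>As the points are distinct, \<open>index\<close> inverts \<open>point\<close>; this is
  what covers the version with bijections.\<close>

lemma bij_betw_index: "bij_betw index (range point) UNIV"
proof (rule bij_betw_byWitness[of _ point])
  have eq: "index (point i) = i" for i
    unfolding index_def using injD[OF inj_point] by (intro Least_equality) auto
  show "\<forall>x\<in>range point. point (index x) = x" "\<forall>i\<in>UNIV. index (point i) = i" using eq by auto
qed auto

lemma codes_height: "codes_real_fun (\<lambda>h. bad_code Fs (\<lambda>n. h (Suc n))) height"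
  unfolding codes_real_fun_def by (auto intro!: codes_real_const real_code_bad_code)

lemma realises:
  assumes "spec_k (\<lambda>Y D. bij_betw Y D UNIV) \<Lambda>"
  shows "\<exists>p x. outputs \<Lambda> [\<lambda>q. of_bool (\<exists>i. is_pick Fs q i), pick_index Fs,
      \<lambda>h. bad_code Fs (\<lambda>n. h (Suc n)), \<lambda>h. bad_code Fs (\<lambda>n. h (Suc n))] p \<and>
    codes_real p x \<and> x \<in> (\<Inter>n. Os n)"
proof -
  let ?Fs = "[\<lambda>q. of_bool (\<exists>i. is_pick Fs q i), pick_index Fs,
      \<lambda>h. bad_code Fs (\<lambda>n. h (Suc n)), \<lambda>h. bad_code Fs (\<lambda>n. h (Suc n))]"
  have "range point \<subseteq> {0..1}" using point_unit by blast
  hence "\<exists>p x. outputs \<Lambda> ?Fs p \<and> codes_real p x \<and>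
      (x \<in> range point \<and> \<not> continuous (at x within {0..1}) height \<or>
       x \<in> {0..1} - range point \<and> continuous (at x within {0..1}) height)"
    by (intro assms[unfolded spec_k_def, rule_format, of "range point" index height height] conjI ballI countable_image
      countableI_type range_point_dense bij_betw_index baire1_height osc_height codes_range_point codes_index codes_height)
  then obtain p x where p: "outputs \<Lambda> ?Fs p" "codes_real p x"
    and x: "x \<in> range point \<and> \<not> continuous (at x within {0..1}) height \<or>
      x \<in> {0..1} - range point \<and> continuous (at x within {0..1}) height" by (elim exE conjE)
  \<comment> \<open>The oscillation is the height, which is 0 on the dense sequence. This rules out
    the first alternative of the answer.\<close>
  have "continuous (at (point i) within {0..1}) height" for i
    by (rule continuous_if_osc_le_0[OF point_unit]) (simp add: osc_height[OF point_unit] height_point)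
  with x have "x \<in> {0..1}" "x \<notin> range point" "continuous (at x within {0..1}) height" by auto
  hence "x \<in> Os n" for n using in_all_Os continuous_imp_height_eq_0 by blast
  with p show ?thesis by blast
qed

end

lemma spec_k_imp_baire_realiser:
  "\<exists>e. \<forall>\<Lambda>. spec_k (\<lambda>Y D. bij_betw Y D UNIV) \<Lambda> \<longrightarrow> baire_realiser (computed e \<Lambda>)"
proof -
  from computed_eq[OF computable_baire_query] obtain e where e:
    "\<And>(\<Gamma> :: ptp3) F m. \<Gamma> (baire_query F) = Some m \<Longrightarrow> computed e \<Gamma> F = Some m" by blast
  show ?thesis
    unfolding baire_realiser_def
  proof (intro exI[of _ e] allI impI)
    fix \<Lambda> and Os :: "nat \<Rightarrow> real set" and Fs
    assume \<Lambda>: "spec_k (\<lambda>Y D. bij_betw Y D UNIV) \<Lambda>"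
      and "\<forall>n. Os n \<subseteq> {0..1} \<and> {0..1} \<subseteq> closure (Os n) \<and> openin (top_of_set {0..1}) (Os n) \<and>
        codes_set (Fs n) (Os n)"
    then interpret dense_open_seq Os Fs by unfold_locales auto
    from realises[OF \<Lambda>] show "\<exists>p x. outputs (computed e \<Lambda>) [join Fs] p \<and> codes_real p x \<and> x \<in> (\<Inter>n. Os n)"
      using outputs_computed[OF e baire_query_tuple] by blast
  qed
qed

lemma spec_k_mono: "(\<And>Y D. S Y D \<Longrightarrow> R Y D) \<Longrightarrow> spec_k R \<Gamma> \<Longrightarrow> spec_k S \<Gamma>"
  unfolding spec_k_def by blast

theorem corollary2p5:
  shows "comp_equiv_E2 baire_realiser (spec_k (\<lambda>Y D. inj_on Y D)) \<and>
         comp_equiv_E2 baire_realiser (spec_k (\<lambda>Y D. bij_betw Y D UNIV))"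
proof -
  \<comment> \<open>Bijections are injections, so (k) for injections implies (k) for bijections. One
    reduction yields the stronger specification and the other uses the weaker one, so the two give
    both equivalences.\<close>
  have inj: "spec_k (\<lambda>Y D. inj_on Y D) \<Gamma> \<Longrightarrow> spec_k (\<lambda>Y D. bij_betw Y D UNIV) \<Gamma>" for \<Gamma>
    by (rule spec_k_mono) (auto simp: bij_betw_def)
  obtain e d where "\<And>\<Gamma>. baire_realiser \<Gamma> \<Longrightarrow> spec_k (\<lambda>Y D. inj_on Y D) (computed e \<Gamma>)"
    "\<And>\<Lambda>. spec_k (\<lambda>Y D. bij_betw Y D UNIV) \<Lambda> \<Longrightarrow> baire_realiser (computed d \<Lambda>)"
    using baire_realiser_imp_spec_k spec_k_imp_baire_realiser by blast
  with inj show ?thesis unfolding comp_equiv_E2_def by blast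
qed

end
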